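(* Let $A$ be a finite local commutative ring. Then the crosscap number $\overline{\gamma}(L(EG(A)))$ of the line graph of the essential graph of $A$ is neither $1$ nor $2$.
   Context: All rings have unity $1\neq 0$. A ring is local if it has exactly one maximal ideal. An ideal $I$ of a commutative ring $A$ is essential if $I\cap J\neq 0$ for every non-zero ideal $J$ of $A$ (so $A$ itself is essential). For $s\in A$, $\mathrm{ann}_A(s)=\{r\in A : sr=0\}$. The essential graph $EG(A)$ is the simple undirected graph whose vertices are the non-zero zero-divisors of $A$, two distinct vertices $u,v$ being adjacent if and only if $\mathrm{ann}_A(uv)$ is an essential ideal of $A$. The line graph $L(G)$ of a graph $G$ has the edges of $G$ as vertices, two distinct ones being adjacent exactly when the corresponding edges share an endpoint in $G$. The crosscap number $\overline{\gamma}(G)$ of a graph $G$ is the least integer $k\ge 0$ such that $G$ can be drawn without edge crossings on $N_k$, the surface obtained from the sphere by attaching $k$ crosscaps ($N_0$ being the sphere, so planar graphs have crosscap number $0$). *)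

theory Defs
  imports
    "HOL-Analysis.Analysis"
    "HOL-Library.Extended_Nat"
    "HOL-Algebra.Ideal"
begin

section \<open>Simple graphs and line graphs\<close>

text \<open>An edge is the two-element set of its endpoints.\<close>

record 'v sgraph =
  vertices :: "'v set"
  edges :: "'v set set"

definition line_graph :: "'v sgraph \<Rightarrow> 'v set sgraph" where
  "line_graph G =
    \<lparr>vertices = edges G,
     edges = {{e, f} | e f. e \<in> edges G \<and> f \<in> edges G \<and> e \<noteq> f \<and> e \<inter> f \<noteq> {}}\<rparr>"


section \<open>The essential graph of a commutative ring\<close>

definition local_ring :: "('a, 'm) ring_scheme \<Rightarrow> bool" where
  "local_ring R \<longleftrightarrow> (\<exists>!M. maximalideal M R)"

definition essential_ideal :: "'a set \<Rightarrow> ('a, 'm) ring_scheme \<Rightarrow> bool" where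
  "essential_ideal I R \<longleftrightarrow>
    ideal I R \<and> (\<forall>J. ideal J R \<and> J \<noteq> {\<zero>\<^bsub>R\<^esub>} \<longrightarrow> I \<inter> J \<noteq> {\<zero>\<^bsub>R\<^esub>})"

definition annihilator :: "('a, 'm) ring_scheme \<Rightarrow> 'a \<Rightarrow> 'a set" where
  "annihilator R s = {r \<in> carrier R. s \<otimes>\<^bsub>R\<^esub> r = \<zero>\<^bsub>R\<^esub>}"

definition nonzero_zero_divisors :: "('a, 'm) ring_scheme \<Rightarrow> 'a set" where
  "nonzero_zero_divisors R =
    {u \<in> carrier R. u \<noteq> \<zero>\<^bsub>R\<^esub> \<and>
      (\<exists>w \<in> carrier R. w \<noteq> \<zero>\<^bsub>R\<^esub> \<and> u \<otimes>\<^bsub>R\<^esub> w = \<zero>\<^bsub>R\<^esub>)}"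

definition essential_graph :: "('a, 'm) ring_scheme \<Rightarrow> 'a sgraph" where
  "essential_graph R =
    \<lparr>vertices = nonzero_zero_divisors R,
     edges = {{u, v} | u v. u \<in> nonzero_zero_divisors R \<and> v \<in> nonzero_zero_divisors R \<and>
       u \<noteq> v \<and> essential_ideal (annihilator R (u \<otimes>\<^bsub>R\<^esub> v)) R}\<rparr>"


section \<open>The surface obtained from the sphere by attaching crosscaps\<close>

definition quotient_topology :: "'p topology \<Rightarrow> ('p \<Rightarrow> 'q) \<Rightarrow> 'q topology" where
  "quotient_topology X f =
    topology (\<lambda>U. U \<subseteq> f ` topspace X \<and> openin X {x \<in> topspace X. f x \<in> U})"

lemma openin_quotient_topology:
  "openin (quotient_topology X f) U \<longleftrightarrow>
    U \<subseteq> f ` topspace X \<and> openin X {x \<in> topspace X. f x \<in> U}"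
proof -
  have int: "{x \<in> topspace X. f x \<in> S \<inter> T} =
      {x \<in> topspace X. f x \<in> S} \<inter> {x \<in> topspace X. f x \<in> T}" for S T
    by auto
  have un: "{x \<in> topspace X. f x \<in> \<Union>\<K>} = (\<Union>S\<in>\<K>. {x \<in> topspace X. f x \<in> S})" for \<K>
    by auto
  have "istopology (\<lambda>U. U \<subseteq> f ` topspace X \<and> openin X {x \<in> topspace X. f x \<in> U})"
    unfolding istopology_def int un by auto
  then show ?thesis
    by (simp add: quotient_topology_def)
qed

lemma topspace_quotient_topology: "topspace (quotient_topology X f) = f ` topspace X"
proof
  have "openin (quotient_topology X f) (topspace (quotient_topology X f))"
    by (rule openin_topspace)
  then show "topspace (quotient_topology X f) \<subseteq> f ` topspace X"
    unfolding openin_quotient_topology by (rule conjunct1)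
  have "{x \<in> topspace X. f x \<in> f ` topspace X} = topspace X"
    by auto
  then have "openin (quotient_topology X f) (f ` topspace X)"
    unfolding openin_quotient_topology by simp
  then show "f ` topspace X \<subseteq> topspace (quotient_topology X f)"
    by (rule openin_subset)
qed

lemma quotient_map_quotient_topology: "quotient_map X (quotient_topology X f) f"
  by (simp add: quotient_map_def topspace_quotient_topology openin_quotient_topology)

text \<open>
  The sphere is the unit sphere of \<open>\<complex> \<times> \<real>\<close>.  To attach \<open>k\<close> crosscaps, we remove \<open>k\<close> open round
  caps, of angular radius \<open>pi / (2 * k)\<close> and with centres equally spaced along the equator (so that
  the closed caps are disjoint), and identify antipodal points on each of the \<open>k\<close> boundary circles.
\<close>

definition cap_centre :: "nat \<Rightarrow> nat \<Rightarrow> complex \<times> real" where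
  "cap_centre k i = (cis (2 * pi * real i / real k), 0)"

definition open_cap :: "nat \<Rightarrow> nat \<Rightarrow> (complex \<times> real) set" where
  "open_cap k i = {x \<in> sphere 0 1. x \<bullet> cap_centre k i > cos (pi / (2 * real k))}"

definition cap_rim :: "nat \<Rightarrow> nat \<Rightarrow> (complex \<times> real) set" where
  "cap_rim k i = {x \<in> sphere 0 1. x \<bullet> cap_centre k i = cos (pi / (2 * real k))}"

text \<open>
  For \<open>x\<close> on the \<open>i\<close>-th boundary circle, the midpoint of that circle in the ambient space is
  \<open>(x \<bullet> cap_centre k i) *\<^sub>R cap_centre k i\<close>; the antipode of \<open>x\<close> is its reflection in the midpoint.
\<close>

definition rim_antipode :: "nat \<Rightarrow> nat \<Rightarrow> complex \<times> real \<Rightarrow> complex \<times> real" where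
  "rim_antipode k i x = (2 * (x \<bullet> cap_centre k i)) *\<^sub>R cap_centre k i - x"

definition holed_sphere :: "nat \<Rightarrow> (complex \<times> real) set" where
  "holed_sphere k = sphere 0 1 - (\<Union>i<k. open_cap k i)"

definition crosscap_class :: "nat \<Rightarrow> complex \<times> real \<Rightarrow> (complex \<times> real) set" where
  "crosscap_class k x = insert x {rim_antipode k i x | i. i < k \<and> x \<in> cap_rim k i}"

definition crosscap_surface :: "nat \<Rightarrow> (complex \<times> real) set topology" where
  "crosscap_surface k = quotient_topology (top_of_set (holed_sphere k)) (crosscap_class k)"

lemma inner_cap_centre_self: "cap_centre k i \<bullet> cap_centre k i = 1"
  by (simp add: cap_centre_def inner_prod_def inner_complex_def flip: power2_eq_square)

lemma closed_caps_disjoint: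
  assumes "i < k" "j < k" and x: "x \<in> open_cap k i \<union> cap_rim k i" "x \<in> open_cap k j \<union> cap_rim k j"
  shows "i = j"
proof (rule ccontr)
  assume "i \<noteq> j"
  have *: False if ij: "i < j" "j < k" and x: "x \<in> sphere 0 1"
    "x \<bullet> cap_centre k i \<ge> cos (pi / (2 * real k))"
    "x \<bullet> cap_centre k j \<ge> cos (pi / (2 * real k))" for i j
  proof -
    define C where "C = cos (pi / (2 * real k))"
    define d where "d = pi * (real j - real i) / real k"
    have k: "k \<ge> 2" using ij by linarith
    have C: "C > 0"
      unfolding C_def using k by (intro cos_gt_zero) (auto simp: field_simps)
    have "cap_centre k i \<bullet> cap_centre k j = cos (2 * d)"
    proof -
      have "2 * d = 2 * pi * real j / real k - 2 * pi * real i / real k"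
        by (simp add: d_def diff_divide_distrib algebra_simps)
      then show ?thesis
        by (simp add: cap_centre_def inner_prod_def inner_complex_def cos_diff mult.commute)
    qed
    then have "(norm (cap_centre k i + cap_centre k j))\<^sup>2 = 2 + 2 * cos (2 * d)"
      by (simp add: power2_norm_eq_inner inner_add_left inner_add_right inner_cap_centre_self
          inner_commute)
    also have "\<dots> = \<bar>2 * cos d\<bar>\<^sup>2"
      by (simp add: cos_double_cos power2_eq_square)
    finally have n: "norm (cap_centre k i + cap_centre k j) = \<bar>2 * cos d\<bar>"
      by (rule power2_eq_imp_eq) simp_all
    have "2 * C \<le> x \<bullet> (cap_centre k i + cap_centre k j)"
      using x by (simp add: C_def inner_add_right)
    also have "\<dots> \<le> norm x * norm (cap_centre k i + cap_centre k j)"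
      by (rule norm_cauchy_schwarz)
    also have "\<dots> = 2 * \<bar>cos d\<bar>"
      using x n by simp
    finally have le: "C \<le> \<bar>cos d\<bar>" by simp
    have d1: "pi / real k \<le> d"
      unfolding d_def using ij k by (intro divide_right_mono) auto
    have "real j - real i \<le> real k - 1" using ij by linarith
    then have d2: "d \<le> pi - pi / real k"
    proof -
      assume "real j - real i \<le> real k - 1"
      then have "d \<le> pi * (real k - 1) / real k"
        unfolding d_def using k by (intro divide_right_mono mult_left_mono) auto
      also have "\<dots> = pi - pi / real k"
        using k by (simp add: field_simps)
      finally show ?thesis .
    qed
    have p: "0 < pi / real k" "pi / real k \<le> pi" using k by (auto simp: field_simps)
    have "cos d \<le> cos (pi / real k)"
      using d1 d2 p by (intro cos_monotone_0_pi_le) auto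
    moreover have "cos (pi - pi / real k) \<le> cos d"
      using d1 d2 p by (intro cos_monotone_0_pi_le) auto
    ultimately have "\<bar>cos d\<bar> \<le> cos (pi / real k)"
      by simp
    also have "\<dots> < C"
      unfolding C_def using k by (intro cos_monotone_0_pi) (auto simp: field_simps)
    finally show False using le by simp
  qed
  have "x \<in> sphere 0 1" "x \<bullet> cap_centre k i \<ge> cos (pi / (2 * real k))"
    "x \<bullet> cap_centre k j \<ge> cos (pi / (2 * real k))"
    using x by (auto simp: open_cap_def cap_rim_def)
  then show False
    using *[of i j] *[of j i] assms(1,2) \<open>i \<noteq> j\<close> by (meson nat_neq_iff)
qed

lemma rim_antipode_in_cap_rim:
  assumes "x \<in> cap_rim k i"
  shows "rim_antipode k i x \<in> cap_rim k i"
proof -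
  have "norm (rim_antipode k i x) = norm x"
    by (simp add: norm_eq_sqrt_inner rim_antipode_def inner_diff_left inner_diff_right
        inner_cap_centre_self inner_commute)
  then show ?thesis
    using assms by (simp add: cap_rim_def rim_antipode_def inner_diff_left inner_cap_centre_self)
qed

lemma rim_antipode_involution: "rim_antipode k i (rim_antipode k i x) = x"
  by (simp add: rim_antipode_def inner_diff_left inner_cap_centre_self)

lemma crosscap_class_eq_iff:
  "crosscap_class k x = crosscap_class k y \<longleftrightarrow>
    x = y \<or> (\<exists>i<k. x \<in> cap_rim k i \<and> y = rim_antipode k i x)"
proof
  assume "crosscap_class k x = crosscap_class k y"
  then have "y \<in> crosscap_class k x"
    unfolding crosscap_class_def by blast
  then show "x = y \<or> (\<exists>i<k. x \<in> cap_rim k i \<and> y = rim_antipode k i x)"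
    by (auto simp: crosscap_class_def)
next
  have *: "crosscap_class k z = {z, rim_antipode k i z}" if iz: "i < k" "z \<in> cap_rim k i" for i z
  proof -
    have ji: "j = i" if jz: "j < k" "z \<in> cap_rim k j" for j
      by (rule closed_caps_disjoint[OF jz(1) iz(1) UnI2[OF jz(2)] UnI2[OF iz(2)]])
    have "{rim_antipode k j z | j. j < k \<and> z \<in> cap_rim k j} = {rim_antipode k i z}"
    proof (intro subset_antisym subsetI)
      fix y assume "y \<in> {rim_antipode k j z | j. j < k \<and> z \<in> cap_rim k j}"
      then obtain j where j: "y = rim_antipode k j z" "j < k" "z \<in> cap_rim k j"
        by blast
      show "y \<in> {rim_antipode k i z}"
        using j(1) unfolding ji[OF j(2,3)] by (rule ssubst) (rule singletonI)
    next
      fix y assume "y \<in> {rim_antipode k i z}"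
      then show "y \<in> {rim_antipode k j z | j. j < k \<and> z \<in> cap_rim k j}"
        using iz by blast
    qed
    then show ?thesis
      unfolding crosscap_class_def by (rule arg_cong)
  qed
  assume "x = y \<or> (\<exists>i<k. x \<in> cap_rim k i \<and> y = rim_antipode k i x)"
  then show "crosscap_class k x = crosscap_class k y"
  proof
    assume "\<exists>i<k. x \<in> cap_rim k i \<and> y = rim_antipode k i x"
    then obtain i where i: "i < k" "x \<in> cap_rim k i" "y = rim_antipode k i x"
      by blast
    have "y \<in> cap_rim k i" "rim_antipode k i y = x"
      unfolding i(3) by (rule rim_antipode_in_cap_rim[OF i(2)]) (rule rim_antipode_involution)
    then have "crosscap_class k y = {y, x}"
      using *[OF i(1)] by metis
    also have "\<dots> = {x, y}"
      by (rule insert_commute)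
    also have "\<dots> = crosscap_class k x"
      unfolding i(3) by (rule *[OF i(1,2), symmetric])
    finally show ?thesis
      by (rule sym)
  qed (rule arg_cong)
qed


section \<open>Drawings without crossings and the crosscap number\<close>

definition drawable_on :: "'v sgraph \<Rightarrow> 'p topology \<Rightarrow> bool" where
  "drawable_on G X \<longleftrightarrow>
    (\<exists>(p :: 'v \<Rightarrow> 'p) (g :: 'v set \<Rightarrow> real \<Rightarrow> 'p).
      inj_on p (vertices G) \<and> p ` vertices G \<subseteq> topspace X \<and>
      (\<forall>e \<in> edges G.
        pathin X (g e) \<and> inj_on (g e) {0..1} \<and> {g e 0, g e 1} = p ` e \<and>
        g e ` {0<..<1} \<inter> p ` vertices G = {}) \<and>
      (\<forall>e \<in> edges G. \<forall>f \<in> edges G. e \<noteq> f \<longrightarrow> g e ` {0<..<1} \<inter> g f ` {0<..<1} = {}))"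

text \<open>
  The infimum in \<open>enat\<close> is the least such \<open>k\<close> whenever one exists, as is the case for every finite
  graph; otherwise it is \<open>\<infinity>\<close>.
\<close>

definition crosscap_number :: "'v sgraph \<Rightarrow> enat" where
  "crosscap_number G = Inf {enat k | k. drawable_on G (crosscap_surface k)}"

end

theory Submission
  imports Defs "HOL-Algebra.Sylow" "HOL-Algebra.Multiplicative_Group"
begin

text \<open>
  In a finite local ring with maximal ideal \<open>M\<close> every element of \<open>M\<close> is nilpotent.  A nilpotent
  element \<open>w\<close> kills some nonzero element of every nonzero ideal (multiply by \<open>w\<close> until just before
  the result vanishes), so its annihilator is essential.  Hence the essential graph is the complete
  graph on the \<open>n = |M| - 1\<close> nonzero elements of \<open>M\<close>.  The case \<open>n = 5\<close> does not occur:
  \<open>M\<close> would contain elements of additive order 2 and 3, which puts \<open>1 + 1\<close> and \<open>1 + 1 + 1\<close>, and so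
  also \<open>1\<close>, into \<open>M\<close> (\<open>card_M_neq_6\<close>).

  If \<open>n \<le> 4\<close>, the line graph is a subgraph of the octahedron, which is drawn on the sphere with
  great circle arcs, and the crosscap number is 0 (\<open>drawable_on_sphere_line_graph\<close>).  If \<open>n \<ge> 6\<close>,
  the line graph has at least four times as many edges as vertices, and it remains to see that a
  graph on the surface with one or two crosscaps has at most about three times as many.

  That bound is reduced to the plane.  The surface with two crosscaps is the Klein bottle, whose
  universal cover is the plane.  A drawing of \<open>V\<close> vertices and \<open>E\<close> edges lifts to a drawing in the
  plane that is invariant under the deck transformations; those copies of the edges whose index lies
  in an \<open>N \<times> N\<close> square form a finite plane graph with \<open>E N\<^sup>2\<close> edges and at most
  \<open>V (N + constant)\<^sup>2\<close> vertices.  The bound \<open>E \<le> 3 V\<close> for plane graphs gives the same bound on the Klein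
  bottle as \<open>N\<close> grows (\<open>card_arcs_le_klein_bottle\<close>).  The surface with one crosscap is the projective
  plane; without one point it is an open Moebius band, which embeds into the Klein bottle.  Choosing
  that point in the middle of an edge costs a single edge.

  The bound for the plane (\<open>plane_drawing.card_arcs_le\<close>) follows the classical count of faces, for
  arcs that are merely continuous.  When an arc is added to a drawing, Janiszewski's theorem and
  the Jordan curve theorem tell what happens to the face in which it lies: the face splits into
  exactly two if the endpoints were joined already, and it stays connected otherwise.  This gives
  both Euler's inequality and the fact that an arc borders at most two faces; each face is bordered by
  at least three arcs (if there are that many), since two arcs do not separate the plane.
\<close>

section \<open>Faces of a compact set in the plane\<close>

text \<open>
  An arc containing an open set would, read backwards, embed a piece of the plane into the line;
  this contradicts invariance of dimension.
\<close>

lemma interior_arc_empty: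
  fixes \<gamma> :: "real \<Rightarrow> complex"
  assumes "arc \<gamma>"
  shows "interior (path_image \<gamma>) = {}"
proof (rule ccontr)
  assume ne: "interior (path_image \<gamma>) \<noteq> {}"
  obtain h where h: "homeomorphism {0..1} (path_image \<gamma>) \<gamma> h"
    using homeomorphism_arc[OF assms] by blast
  have "continuous_on (interior (path_image \<gamma>)) h"
    by (meson h homeomorphism_def continuous_on_subset interior_subset)
  moreover have "inj_on h (interior (path_image \<gamma>))"
    using h interior_subset[of "path_image \<gamma>"] by (intro inj_on_subset[OF inj_on_inverseI[of "path_image \<gamma>" \<gamma>]]) (auto simp: homeomorphism_def)
  ultimately have "DIM(complex) \<le> DIM(real)"
    using invariance_of_dimension[of "interior (path_image \<gamma>)" h] ne by simp
  then show False by simp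
qed

lemma in_components_eq_connected_component_set:
  assumes "U \<in> components S" "a \<in> U"
  shows "U = connected_component_set S a"
proof -
  obtain x where "U = connected_component_set S x"
    using assms(1) unfolding components_iff by blast
  then show ?thesis
    using connected_component_eq[of a S x] assms(2) by simp
qed

lemma components_superset:
  assumes "U \<in> components S" "S \<subseteq> T"
  shows "\<exists>!W. W \<in> components T \<and> U \<subseteq> W"
proof -
  obtain x where x: "x \<in> U" using assms(1) in_components_nonempty by blast
  obtain W where W: "W \<in> components T" "U \<subseteq> W"
    using exists_component_superset[of U T] assms in_components_connected in_components_subset
    by (metis in_components_nonempty subset_empty subset_trans)
  show ?thesis
  proof (rule ex1I[of _ W])
    fix W' assume "W' \<in> components T \<and> U \<subseteq> W'"
    then show "W' = W" using W x components_eq[of W' T W] by blast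
  qed (use W in blast)
qed

text \<open>
  Here \<open>X\<close> and \<open>Y\<close> are the two sides of a set that is being added to
  \<open>K\<close>.  If points on the same side that were not separated before stay unseparated,
  then a face is cut into at most one piece per side.
\<close>

lemma components_finer:
  fixes K :: "'a::topological_space set"
  assumes "open X" "open Y" "X \<inter> Y = {}" "- (K \<union> E) \<subseteq> X \<union> Y"
    and sep: "\<forall>Z \<in> {X, Y}. \<forall>a \<in> Z - (K \<union> E). \<forall>b \<in> Z - (K \<union> E).
      connected_component (- K) a b \<longrightarrow> connected_component (- (K \<union> E)) a b"
  shows components_finer_card: "W \<in> components (- K) \<Longrightarrow> card {U \<in> components (- (K \<union> E)). U \<subseteq> W} \<le> 2"
    and components_finer_finite: "finite (components (- K)) \<Longrightarrow> finite (components (- (K \<union> E)))"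
proof -
  let ?F = "\<lambda>W. {U \<in> components (- (K \<union> E)). U \<subseteq> W}"
  have side: "U \<subseteq> X \<or> U \<subseteq> Y" if "U \<in> components (- (K \<union> E))" for U
  proof (rule ccontr)
    assume "\<not> ?thesis"
    moreover have "U \<subseteq> X \<union> Y" using in_components_subset[OF that] assms(4) by blast
    ultimately have "X \<inter> U \<noteq> {}" "Y \<inter> U \<noteq> {}" by blast+
    then show False
      using connectedD[OF in_components_connected[OF that] assms(1,2)] assms(3) \<open>U \<subseteq> X \<union> Y\<close> by blast
  qed
  have inj: "inj_on (\<lambda>U. U \<subseteq> X) (?F W)" if W: "W \<in> components (- K)" for W
  proof (rule inj_onI)
    fix U U' assume U: "U \<in> ?F W" "U' \<in> ?F W" and eq: "(U \<subseteq> X) = (U' \<subseteq> X)"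
    obtain Z where Z: "Z \<in> {X, Y}" "U \<subseteq> Z" "U' \<subseteq> Z"
      using side U eq by blast
    obtain a b where ab: "a \<in> U" "b \<in> U'" using U in_components_nonempty by blast
    then have "a \<in> W" "b \<in> W" using U by auto
    then have "connected_component (- K) a b"
      by (intro connected_componentI[of W]) (use W in_components_connected[OF W] in_components_subset[OF W] in auto)
    moreover have "a \<in> Z - (K \<union> E)" "b \<in> Z - (K \<union> E)"
      using ab U Z in_components_subset[of U "- (K \<union> E)"] in_components_subset[of U' "- (K \<union> E)"] by auto
    ultimately have "connected_component (- (K \<union> E)) a b" by (intro sep[rule_format, OF Z(1)])
    then have "connected_component_set (- (K \<union> E)) a = connected_component_set (- (K \<union> E)) b"
      by (simp add: connected_component_eq)
    then show "U = U'"
      using U ab in_components_eq_connected_component_set[of _ "- (K \<union> E)"] by blast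
  qed
  have fin: "finite (?F W)" if "W \<in> components (- K)" for W
    using inj_on_finite[OF inj[OF that], of UNIV] by simp
  show "card (?F W) \<le> 2" if "W \<in> components (- K)" for W
    using card_inj_on_le[OF inj[OF that], of UNIV] by (simp add: card_UNIV_bool)
  show "finite (components (- (K \<union> E)))" if "finite (components (- K))"
  proof -
    have "components (- (K \<union> E)) \<subseteq> (\<Union>W \<in> components (- K). ?F W)"
    proof
      fix U assume U: "U \<in> components (- (K \<union> E))"
      obtain W where "W \<in> components (- K)" "U \<subseteq> W"
        using components_superset[OF U, of "- K"] by auto
      with U show "U \<in> (\<Union>W \<in> components (- K). ?F W)" by auto
    qed
    then show ?thesis
      by (rule finite_subset) (intro finite_UN_I that fin)
  qed
qed

text \<open>
  Every face of \<open>K\<close> contains a face of \<open>K \<union> E\<close>, because a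
  nonempty open set is not swallowed by \<open>E\<close>; the number of faces grows as soon as
  one face contains two.
\<close>

lemma card_components_mono:
  fixes K :: "complex set"
  assumes "closed K" "interior E = {}" "finite (components (- (K \<union> E)))"
  shows "card (components (- K)) \<le> card (components (- (K \<union> E)))"
    and "\<lbrakk>U \<in> components (- (K \<union> E)); U' \<in> components (- (K \<union> E)); U \<noteq> U';
          W \<in> components (- K); U \<subseteq> W; U' \<subseteq> W\<rbrakk> \<Longrightarrow> card (components (- K)) < card (components (- (K \<union> E)))"
proof -
  define up where "up U = (THE W. W \<in> components (- K) \<and> U \<subseteq> W)" for U
  have up: "up U \<in> components (- K) \<and> U \<subseteq> up U" if "U \<in> components (- (K \<union> E))" for U
    unfolding up_def by (rule theI', rule components_superset[OF that]) auto
  have upI: "up U = W" if "U \<in> components (- (K \<union> E))" "W \<in> components (- K)" "U \<subseteq> W" for U W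
    using components_superset[OF that(1), of "- K"] up[OF that(1)] that(2,3) by blast
  have surj: "components (- K) \<subseteq> up ` components (- (K \<union> E))"
  proof
    fix W assume W: "W \<in> components (- K)"
    have "open W" using W assms(1) open_components by blast
    then have "\<not> W \<subseteq> E"
      using assms(2) in_components_nonempty[OF W] interior_maximal by blast
    then obtain x where x: "x \<in> W" "x \<notin> E" by blast
    then have "x \<in> - (K \<union> E)" using in_components_subset[OF W] by blast
    then obtain U where U: "U \<in> components (- (K \<union> E))" "x \<in> U"
      by (metis Union_components UnionE)
    then have "up U = W"
      using up[OF U(1)] x W components_eq[of W "- K" "up U"] by blast
    then show "W \<in> up ` components (- (K \<union> E))" using U by blast
  qed
  show "card (components (- K)) \<le> card (components (- (K \<union> E)))"
    by (rule surj_card_le[OF assms(3) surj])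
  assume U: "U \<in> components (- (K \<union> E))" "U' \<in> components (- (K \<union> E))" "U \<noteq> U'"
          "W \<in> components (- K)" "U \<subseteq> W" "U' \<subseteq> W"
  have "components (- K) \<subseteq> up ` (components (- (K \<union> E)) - {U'})"
  proof
    fix W' assume "W' \<in> components (- K)"
    then obtain U'' where "U'' \<in> components (- (K \<union> E))" "W' = up U''" using surj by blast
    then show "W' \<in> up ` (components (- (K \<union> E)) - {U'})"
      using upI[OF U(1) U(4,5)] upI[OF U(2) U(4,6)] U(1,3) by (cases "U'' = U'") auto
  qed
  then have "card (components (- K)) \<le> card (components (- (K \<union> E)) - {U'})"
    by (rule surj_card_le[rotated]) (use assms(3) in blast)
  also have "\<dots> < card (components (- (K \<union> E)))"
    by (rule card_Diff1_less[OF assms(3) U(2)])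
  finally show "card (components (- K)) < card (components (- (K \<union> E)))" .
qed

text \<open>
  An arc \<open>r\<close> in \<open>K\<close> closes \<open>e\<close> up to a simple closed
  curve \<open>J\<close>, and \<open>X\<close>, \<open>Y\<close> are the inside and the outside
  of \<open>J\<close>.  The point is that \<open>J \<inter> K = r\<close> is connected: by
  Janiszewski's theorem two points separated neither by \<open>J\<close> nor by \<open>K\<close>
  are not separated by \<open>J \<union> K = K \<union> e\<close>.
\<close>

lemma arc_closing_cycle:
  fixes K :: "complex set"
  assumes K: "compact K" and e: "arc e" "path_image e \<inter> K = {pathstart e, pathfinish e}"
    and con: "path_component K (pathstart e) (pathfinish e)"
  obtains X Y where "open X" "open Y" "X \<inter> Y = {}" "- (K \<union> path_image e) \<subseteq> X \<union> Y"
    "path_image e \<subseteq> closure X" "path_image e \<subseteq> closure Y"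
    "\<forall>Z \<in> {X, Y}. \<forall>a \<in> Z - (K \<union> path_image e). \<forall>b \<in> Z - (K \<union> path_image e).
       connected_component (- K) a b \<longrightarrow> connected_component (- (K \<union> path_image e)) a b"
proof -
  have ends: "pathstart e \<noteq> pathfinish e" using arc_distinct_ends[OF e(1)] by simp
  obtain q where q: "path q" "path_image q \<subseteq> K" "pathstart q = pathfinish e" "pathfinish q = pathstart e"
    using path_component_sym[OF con] unfolding path_component_def by blast
  obtain r where r: "arc r" "path_image r \<subseteq> path_image q" "pathstart r = pathfinish e" "pathfinish r = pathstart e"
    by (rule path_contains_arc[OF q(1,3,4) ends[symmetric]])
  have rK: "path_image r \<subseteq> K" using r q by blast
  have sp: "simple_path (e +++ r)"
    by (rule simple_path_join_loop) (use e r rK in auto)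
  have loop: "pathfinish (e +++ r) = pathstart (e +++ r)" using r by simp
  define J where "J = path_image (e +++ r)"
  have J: "J = path_image e \<union> path_image r" unfolding J_def by (rule path_image_join) (simp add: r)
  note jordan = Jordan_inside_outside[OF sp loop, folded J_def]
  have cJ: "compact J" unfolding J_def using sp simple_path_imp_path compact_path_image by blast
  have "path_image e \<inter> K \<subseteq> path_image r"
    unfolding e(2) using pathstart_in_path_image[of r] pathfinish_in_path_image[of r] unfolding r(3,4) by simp
  then have "J \<inter> K = path_image r"
    using rK unfolding J by blast
  then have conJK: "connected (J \<inter> K)"
    using r(1) arc_imp_path connected_path_image by metis
  have un: "J \<union> K = K \<union> path_image e" using rK unfolding J by blast
  show thesis
  proof
    show "open (inside J)" "open (outside J)" "inside J \<inter> outside J = {}" using jordan by auto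
    show "- (K \<union> path_image e) \<subseteq> inside J \<union> outside J" using jordan un by blast
    show "path_image e \<subseteq> closure (inside J)" "path_image e \<subseteq> closure (outside J)"
      using jordan J unfolding frontier_def by blast+
    have sep: "connected_component (- (K \<union> path_image e)) a b"
      if Z: "Z \<in> {inside J, outside J}" "a \<in> Z - (K \<union> path_image e)" "b \<in> Z - (K \<union> path_image e)"
      and K': "connected_component (- K) a b" for a b Z
    proof -
    have "connected Z" using Z(1) jordan by auto
    moreover have "Z \<subseteq> - J" using Z(1) inside_no_overlap[of J] outside_no_overlap[of J] by blast
    ultimately have "connected_component (- J) a b"
      using Z by (intro connected_componentI[of Z]) auto
    then show ?thesis
      using Janiszewski[OF cJ compact_imp_closed[OF K] conJK _ K'] un by simp
    qed
    then show "\<forall>Z \<in> {inside J, outside J}. \<forall>a \<in> Z - (K \<union> path_image e). \<forall>b \<in> Z - (K \<union> path_image e).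
       connected_component (- K) a b \<longrightarrow> connected_component (- (K \<union> path_image e)) a b"
      by blast
  qed
qed

text \<open>
  An arc that joins two disjoint parts separates nothing new: Janiszewski's theorem applies
  first to \<open>P\<close> and the arc, which meet in one point, and then to their union and
  \<open>Q\<close>, which also meet in one point.
\<close>

lemma arc_joining_parts:
  fixes P Q :: "complex set"
  assumes PQ: "compact P" "compact Q" "P \<inter> Q = {}" and e: "arc e" "path_image e \<inter> P = {pathstart e}"
    "path_image e \<inter> Q = {pathfinish e}"
    and ab: "connected_component (- (P \<union> Q)) a b" "a \<notin> path_image e" "b \<notin> path_image e"
  shows "connected_component (- (P \<union> Q \<union> path_image e)) a b"
proof -
  have ce: "compact (path_image e)" using e(1) by (simp add: arc_imp_path compact_path_image)
  have "connected (- path_image e)" by (rule connected_arc_complement[OF e(1)]) simp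
  then have "connected_component (- path_image e) a b"
    using ab(2,3) by (intro connected_componentI[of "- path_image e"]) auto
  moreover have "connected_component (- P) a b" "connected_component (- Q) a b"
    using ab(1) connected_component_of_subset[of "- (P \<union> Q)"] by auto
  ultimately have "connected_component (- (P \<union> path_image e)) a b"
    using Janiszewski[OF PQ(1) compact_imp_closed[OF ce]] e(2) by (simp add: Int_commute)
  moreover have "(P \<union> path_image e) \<inter> Q = {pathfinish e}" using PQ e by blast
  ultimately have "connected_component (- ((P \<union> path_image e) \<union> Q)) a b"
    using Janiszewski[OF compact_Un[OF PQ(1) ce] compact_imp_closed[OF PQ(2)]] \<open>connected_component (- Q) a b\<close> by simp
  then show ?thesis by (simp add: Un_ac)
qed

section \<open>Plane drawings have at most three times as many arcs as vertices\<close>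

text \<open>
  Enlarging \<open>D\<close> merges path components; this is the count of connected components
  of the drawing in Euler's formula.
\<close>

lemma card_path_components_mono:
  assumes "finite V" "V \<subseteq> D" "D \<subseteq> D'"
  shows "card (path_component_set D' ` V) \<le> card (path_component_set D ` V)"
    and "\<lbrakk>u \<in> V; w \<in> V; \<not> path_component D u w; path_component D' u w\<rbrakk>
      \<Longrightarrow> card (path_component_set D' ` V) < card (path_component_set D ` V)"
proof -
  define f where "f C = (\<Union>x\<in>C. path_component_set D' x)" for C
  have f: "f (path_component_set D v) = path_component_set D' v" if "v \<in> V" for v
  proof -
    have "path_component_set D' x = path_component_set D' v" if "x \<in> path_component_set D v" for x
      using path_component_eq[of x D' v] path_component_of_subset[OF assms(3)] that by auto
    moreover have "v \<in> path_component_set D v"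
      using that assms(2) by (auto intro: path_component_refl)
    ultimately show ?thesis unfolding f_def by blast
  qed
  have sub: "path_component_set D' ` V \<subseteq> f ` path_component_set D ` V"
    using f by force
  show "card (path_component_set D' ` V) \<le> card (path_component_set D ` V)"
    by (rule surj_card_le[OF _ sub]) (use assms(1) in blast)
  assume u: "u \<in> V" "w \<in> V" "\<not> path_component D u w" "path_component D' u w"
  let ?w = "path_component_set D w"
  have "?w \<noteq> path_component_set D u"
    using u(3) path_component_refl[of w D] u(2) assms(2) by blast
  moreover have "path_component_set D' w = path_component_set D' u"
    using path_component_eq[of w D' u] u(4) by simp
  ultimately have uw: "path_component_set D u \<noteq> ?w" "path_component_set D' w = path_component_set D' u"
    by auto
  have "path_component_set D' v \<in> f ` (path_component_set D ` V - {?w})" if "v \<in> V" for v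
  proof (cases "path_component_set D v = ?w")
    case True
    then have "path_component_set D' v = f (path_component_set D u)"
      using f[OF u(1)] f[OF u(2)] f[OF that] uw(2) by simp
    then show ?thesis using uw(1) u(1) by blast
  next
    case False
    then show ?thesis using f[OF that, symmetric] that by blast
  qed
  then have "card (path_component_set D' ` V) \<le> card (path_component_set D ` V - {?w})"
    by (intro surj_card_le[of _ _ f]) (use assms(1) in auto)
  also have "\<dots> < card (path_component_set D ` V)"
    by (rule card_Diff1_less) (use assms(1) u(2) in auto)
  finally show "card (path_component_set D' ` V) < card (path_component_set D ` V)" .
qed

lemma path_image_ends_interior:
  "path_image g = {pathstart g, pathfinish g} \<union> g ` {0<..<1}"
proof -
  have "{0..1} = {0, 1} \<union> {0<..<1::real}" by auto
  then have "g ` {0..1} = {g 0, g 1} \<union> g ` {0<..<1}" by (simp add: image_Un)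
  then show ?thesis unfolding path_image_def pathstart_def pathfinish_def .
qed

lemma doubleton_Int_subset_singleton:
  assumes "{a, b} \<noteq> {c, d}"
  shows "\<exists>x. {a, b} \<inter> {c, d} \<subseteq> {x}"
proof (cases "a \<in> {c, d}")
  case True
  then have "b \<notin> {c, d} \<or> b = a" using assms by auto
  then show ?thesis by (intro exI[of _ a]) auto
qed (intro exI[of _ b], auto)

text \<open>
  Arcs are indexed, so that the edges of a graph or their translates can serve as indices.  The
  last axiom excludes parallel edges, without which no bound on their number could hold.
\<close>

locale arc_drawing =
  fixes V :: "'p::topological_space set" and I :: "'i set" and \<gamma> :: "'i \<Rightarrow> real \<Rightarrow> 'p"
  assumes finite_V: "finite V" and finite_I: "finite I"
    and arcs: "i \<in> I \<Longrightarrow> arc (\<gamma> i)"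
    and ends: "i \<in> I \<Longrightarrow> {pathstart (\<gamma> i), pathfinish (\<gamma> i)} \<subseteq> V"
    and avoid: "i \<in> I \<Longrightarrow> \<gamma> i ` {0<..<1} \<inter> V = {}"
    and disjoint: "\<lbrakk>i \<in> I; j \<in> I; i \<noteq> j\<rbrakk> \<Longrightarrow> \<gamma> i ` {0<..<1} \<inter> \<gamma> j ` {0<..<1} = {}"
    and simple: "inj_on (\<lambda>i. {pathstart (\<gamma> i), pathfinish (\<gamma> i)}) I"

locale plane_drawing = arc_drawing V I \<gamma>
  for V :: "complex set" and I :: "'i set" and \<gamma> :: "'i \<Rightarrow> real \<Rightarrow> complex"
begin

definition drawn :: "'i set \<Rightarrow> complex set" where
  "drawn J = V \<union> (\<Union>j\<in>J. path_image (\<gamma> j))"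

lemma drawn_eq: "J \<subseteq> I \<Longrightarrow> drawn J = V \<union> (\<Union>j\<in>J. \<gamma> j ` {0<..<1})"
proof -
  assume J: "J \<subseteq> I"
  have "path_image (\<gamma> j) \<subseteq> V \<union> \<gamma> j ` {0<..<1}" "\<gamma> j ` {0<..<1} \<subseteq> path_image (\<gamma> j)" if "j \<in> J" for j
    using ends[of j] that J unfolding path_image_ends_interior by auto
  then show ?thesis unfolding drawn_def by (intro subset_antisym Un_least UN_least) blast+
qed

lemma drawn_insert: "drawn (insert i J) = drawn J \<union> path_image (\<gamma> i)"
  unfolding drawn_def by auto

lemma compact_arc: "i \<in> I \<Longrightarrow> compact (path_image (\<gamma> i))"
  by (simp add: arcs arc_imp_path compact_path_image)

lemma compact_drawn: "J \<subseteq> I \<Longrightarrow> compact (drawn J)"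
  unfolding drawn_def
  by (intro compact_Un compact_UN finite_imp_compact finite_V compact_arc)
     (use finite_I finite_subset in auto)

lemma interior_arc_disjoint_drawn:
  assumes "J \<subseteq> I" "i \<in> I - J"
  shows "\<gamma> i ` {0<..<1} \<inter> drawn J = {}"
  using avoid[of i] disjoint[of i] assms unfolding drawn_eq[OF assms(1)] by blast

lemma arc_Int_drawn:
  assumes "J \<subseteq> I" "i \<in> I - J"
  shows "path_image (\<gamma> i) \<inter> drawn J = {pathstart (\<gamma> i), pathfinish (\<gamma> i)}"
  using interior_arc_disjoint_drawn[OF assms] ends[of i] assms(2)
  unfolding path_image_ends_interior[of "\<gamma> i"] drawn_def by auto

text \<open>
  The path component of \<open>s\<close> is a union of some of the finitely many arcs and points
  of the drawing, since these are path connected; hence it and the rest are both compact.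
\<close>

lemma drawn_separation:
  assumes J: "J \<subseteq> I" and s: "s \<in> V" "t \<in> V" "\<not> path_component (drawn J) s t"
  obtains P Q where "compact P" "compact Q" "P \<inter> Q = {}" "drawn J = P \<union> Q" "s \<in> P" "t \<in> Q"
proof -
  define \<X> where "\<X> = (\<lambda>v. {v}) ` V \<union> (\<lambda>j. path_image (\<gamma> j)) ` J"
  define C where "C = path_component_set (drawn J) s"
  have fin: "finite \<X>" unfolding \<X>_def using finite_V finite_I J finite_subset by blast
  have union: "drawn J = \<Union>\<X>" unfolding \<X>_def drawn_def by auto
  have comp: "compact X" if "X \<in> \<X>" for X
    using that J compact_arc unfolding \<X>_def by auto
  have meets: "X \<subseteq> C" if X: "X \<in> \<X>" "X \<inter> C \<noteq> {}" for X
  proof -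
    have "path_connected X"
      using X(1) J arcs unfolding \<X>_def by (auto simp: arc_imp_path path_connected_path_image subset_iff)
    obtain x where x: "x \<in> X" "x \<in> C" using X(2) by blast
    have "X \<subseteq> path_component_set (drawn J) x"
      by (rule path_component_maximal[OF x(1) \<open>path_connected X\<close>]) (use X union in blast)
    also have "\<dots> = C" using x(2) path_component_eq[of x "drawn J" s] unfolding C_def by simp
    finally show ?thesis .
  qed
  show thesis
  proof
    let ?P = "\<Union>{X \<in> \<X>. X \<subseteq> C}" and ?Q = "\<Union>{X \<in> \<X>. \<not> X \<subseteq> C}"
    show "compact ?P" "compact ?Q" by (rule compact_Union; use fin comp in auto)+
    show "?P \<inter> ?Q = {}" using meets by blast
    show "drawn J = ?P \<union> ?Q" unfolding union by blast
    have "s \<in> drawn J" "{s} \<in> \<X>" "{t} \<in> \<X>" using s(1,2) unfolding drawn_def \<X>_def by auto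
    then have "{s} \<subseteq> C" "\<not> {t} \<subseteq> C" unfolding C_def using s(3) path_component_refl by auto
    then show "s \<in> ?P" "t \<in> ?Q" using \<open>{s} \<in> \<X>\<close> \<open>{t} \<in> \<X>\<close> by blast+
  qed
qed

text \<open>
  The two cases of Euler's formula.  An arc whose endpoints are joined in the drawing cuts the
  face around its midpoint into an inner and an outer part; both are nonempty because the arc
  lies in the closure of either side of the closed curve.  Any other arc leaves the faces alone
  and merges two path components.
\<close>

lemma add_arc:
  assumes J: "J \<subseteq> I" and i: "i \<in> I - J" and fin: "finite (components (- drawn J))"
  shows add_arc_finite: "finite (components (- drawn (insert i J)))"
    and add_arc_split: "W \<in> components (- drawn J) \<Longrightarrow>
      card {U \<in> components (- drawn (insert i J)). U \<subseteq> W} \<le> 2"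
    and add_arc_card: "card (components (- drawn J)) + card (path_component_set (drawn (insert i J)) ` V) + 1
      \<le> card (components (- drawn (insert i J))) + card (path_component_set (drawn J) ` V)"
proof -
  let ?K = "drawn J" and ?s = "pathstart (\<gamma> i)" and ?t = "pathfinish (\<gamma> i)" and ?E = "path_image (\<gamma> i)"
  have K: "compact ?K" and cK: "closed ?K" using compact_drawn[OF J] compact_imp_closed by auto
  have arc: "arc (\<gamma> i)" using arcs i by blast
  have E: "interior ?E = {}" by (rule interior_arc_empty[OF arc])
  have Int: "?E \<inter> ?K = {?s, ?t}" by (rule arc_Int_drawn[OF J i])
  have st: "?s \<in> V" "?t \<in> V" using ends i by auto
  have V: "V \<subseteq> ?K" "?K \<subseteq> ?K \<union> ?E" unfolding drawn_def by auto
  have goal: "finite (components (- (?K \<union> ?E))) \<and>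
    (\<forall>W \<in> components (- ?K). card {U \<in> components (- (?K \<union> ?E)). U \<subseteq> W} \<le> 2) \<and>
    card (components (- ?K)) + card (path_component_set (?K \<union> ?E) ` V) + 1
      \<le> card (components (- (?K \<union> ?E))) + card (path_component_set ?K ` V)"
  proof (cases "path_component ?K ?s ?t")
    case True
    obtain X Y where XY: "open X" "open Y" "X \<inter> Y = {}" "- (?K \<union> ?E) \<subseteq> X \<union> Y"
      and cl: "?E \<subseteq> closure X" "?E \<subseteq> closure Y"
      and sep: "\<forall>Z \<in> {X, Y}. \<forall>a \<in> Z - (?K \<union> ?E). \<forall>b \<in> Z - (?K \<union> ?E).
        connected_component (- ?K) a b \<longrightarrow> connected_component (- (?K \<union> ?E)) a b"
      by (rule arc_closing_cycle[OF K arc Int True])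
    note finer = components_finer_card[OF XY sep] components_finer_finite[OF XY sep fin]
    have m: "\<gamma> i (1/2) \<in> ?E" "\<gamma> i (1/2) \<notin> ?K"
      using disjoint_iff[THEN iffD1, OF interior_arc_disjoint_drawn[OF J i], rule_format, of "\<gamma> i (1/2)"]
      by (auto simp: path_image_def)
    obtain W where W: "W \<in> components (- ?K)" "\<gamma> i (1/2) \<in> W"
      using m(2) Union_components[of "- ?K"] by blast
    have "open W" using W cK open_components by blast
    have side: "\<exists>a. a \<in> W \<and> a \<in> Z \<and> a \<notin> ?K \<union> ?E" if "open Z" "?E \<subseteq> closure Z" for Z
    proof -
      have "W \<inter> Z \<noteq> {}"
        using open_Int_closure_eq_empty[OF \<open>open W\<close>, of Z] m(1) W(2) that(2) by blast
      moreover have "open (W \<inter> Z)" using \<open>open W\<close> that(1) by blast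
      ultimately have "\<not> W \<inter> Z \<subseteq> ?E" using E interior_maximal[of "W \<inter> Z" ?E] by blast
      then show ?thesis using in_components_subset[OF W(1)] by blast
    qed
    obtain a b where a: "a \<in> W" "a \<in> X" "a \<notin> ?K \<union> ?E" and b: "b \<in> W" "b \<in> Y" "b \<notin> ?K \<union> ?E"
      using side[OF XY(1) cl(1)] side[OF XY(2) cl(2)] by blast
    obtain A B where A: "A \<in> components (- (?K \<union> ?E))" "a \<in> A" and B: "B \<in> components (- (?K \<union> ?E))" "b \<in> B"
      using a(3) b(3) Union_components[of "- (?K \<union> ?E)"] by blast
    have sub: "U \<subseteq> W" if "U \<in> components (- (?K \<union> ?E))" "x \<in> U" "x \<in> W" for U x
    proof (rule components_maximal[OF W(1)])
      show "connected U" "U \<subseteq> - ?K" using in_components_connected[OF that(1)] in_components_subset[OF that(1)] by auto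
      show "W \<inter> U \<noteq> {}" using that by blast
    qed
    have "A \<noteq> B"
    proof
      assume "A = B"
      then have "X \<inter> A \<noteq> {}" "Y \<inter> A \<noteq> {}" using a b A B by blast+
      moreover have "A \<subseteq> X \<union> Y" using in_components_subset[OF A(1)] XY(4) by blast
      ultimately show False
        using connectedD[OF in_components_connected[OF A(1)] XY(1,2)] XY(3) by blast
    qed
    then have "card (components (- ?K)) < card (components (- (?K \<union> ?E)))"
      using card_components_mono(2)[OF cK E finer(2) A(1) B(1) _ W(1) sub[OF A a(1)] sub[OF B b(1)]] by blast
    then show ?thesis
      using finer card_path_components_mono(1)[OF finite_V V] by auto
  next
    case False
    obtain P Q where PQ: "compact P" "compact Q" "P \<inter> Q = {}" "?K = P \<union> Q" "?s \<in> P" "?t \<in> Q"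
      using drawn_separation[OF J st False] by metis
    have "?E \<inter> P = {?s}" "?E \<inter> Q = {?t}" using Int PQ(3-6) by auto
    note join = arc_joining_parts[OF PQ(1-3) arc this]
    have XY: "open (UNIV :: complex set)" "open ({} :: complex set)" "UNIV \<inter> {} = ({} :: complex set)"
      "- (?K \<union> ?E) \<subseteq> UNIV \<union> {}"
      by auto
    have sep: "\<forall>Z \<in> {UNIV, {}}. \<forall>a \<in> Z - (?K \<union> ?E). \<forall>b \<in> Z - (?K \<union> ?E).
        connected_component (- ?K) a b \<longrightarrow> connected_component (- (?K \<union> ?E)) a b"
      using join unfolding PQ(4) by blast
    note finer = components_finer_card[OF XY sep] components_finer_finite[OF XY sep fin]
    have "path_component (?K \<union> ?E) ?s ?t"
      unfolding path_component_def using arc arc_imp_path by blast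
    then have "card (path_component_set (?K \<union> ?E) ` V) < card (path_component_set ?K ` V)"
      using card_path_components_mono(2)[OF finite_V V st False] by blast
    then show ?thesis
      using finer card_components_mono(1)[OF cK E finer(2)] by auto
  qed
  show "finite (components (- drawn (insert i J)))"
    using goal unfolding drawn_insert by blast
  show "card {U \<in> components (- drawn (insert i J)). U \<subseteq> W} \<le> 2" if "W \<in> components (- drawn J)"
    using goal that unfolding drawn_insert by blast
  show "card (components (- drawn J)) + card (path_component_set (drawn (insert i J)) ` V) + 1
      \<le> card (components (- drawn (insert i J))) + card (path_component_set (drawn J) ` V)"
    using goal unfolding drawn_insert by blast
qed

text \<open>
  Each added arc either creates a face or merges two path components, and the term that counts
  the components records which.
\<close>

lemma euler_inequality:
  assumes "J \<subseteq> I"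
  shows "finite (components (- drawn J)) \<and>
    card J + card (path_component_set (drawn J) ` V) + 1 \<le> card (components (- drawn J)) + card V"
  using finite_subset[OF assms finite_I] assms
proof (induction J rule: finite_induct)
  case empty
  have "connected (UNIV - V)"
    by (rule connected_open_delete_finite) (auto simp: finite_V)
  moreover have "- V \<noteq> {}"
    using finite_V infinite_UNIV_char_0 by (metis Compl_eq_Diff_UNIV Compl_empty_eq Diff_eq_empty_iff compl_bot_eq double_complement)
  ultimately have "components (- drawn {}) = {- V}"
    by (simp add: drawn_def components_eq_sing_iff Compl_eq_Diff_UNIV)
  then show ?case using card_image_le[OF finite_V] by auto
next
  case (insert i J)
  then have J: "J \<subseteq> I" "i \<in> I - J" by auto
  show ?case
    using insert.IH[OF J(1)] add_arc_finite[OF J] add_arc_card[OF J] insert.hyps by auto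
qed

lemma finite_faces: "finite (components (- drawn I))"
  using euler_inequality by blast

text \<open>
  All faces that touch the arc lie in one face of the drawing without it, namely the face
  containing the interior of the arc, and that face is cut into at most two pieces.
\<close>

lemma faces_at_arc:
  assumes i: "i \<in> I"
  shows "card {U \<in> components (- drawn I). closure U \<inter> \<gamma> i ` {0<..<1} \<noteq> {}} \<le> 2"
proof -
  let ?E = "\<gamma> i ` {0<..<1}"
  define J where "J = I - {i}"
  have J: "J \<subseteq> I" "i \<in> I - J" and ins: "insert i J = I" using i unfolding J_def by auto
  have "connected ?E"
    by (rule connected_continuous_image[OF continuous_on_subset[of "{0..1}"]])
       (use arcs[OF i] in \<open>auto simp: arc_def path_def\<close>)
  moreover have "?E \<subseteq> - drawn J" "?E \<noteq> {}" using interior_arc_disjoint_drawn[OF J] by auto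
  ultimately obtain W where W: "W \<in> components (- drawn J)" "?E \<subseteq> W"
    using exists_component_superset[of ?E "- drawn J"] by blast
  have "open W"
    by (rule open_components[OF open_Compl[OF compact_imp_closed[OF compact_drawn[OF J(1)]]] W(1)])
  have "U \<subseteq> W" if U: "U \<in> components (- drawn I)" "closure U \<inter> ?E \<noteq> {}" for U
  proof (rule components_maximal[OF W(1)])
    show "connected U" using in_components_connected[OF U(1)] .
    show "U \<subseteq> - drawn J" using in_components_subset[OF U(1)] drawn_insert[of i J] ins by auto
    show "W \<inter> U \<noteq> {}" using open_Int_closure_eq_empty[OF \<open>open W\<close>, of U] U(2) W(2) by blast
  qed
  then have "card {U \<in> components (- drawn I). closure U \<inter> ?E \<noteq> {}}
      \<le> card {U \<in> components (- drawn I). U \<subseteq> W}"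
    by (intro card_mono) (use finite_faces in auto)
  also have "\<dots> \<le> 2"
    using add_arc_split[OF J _ W(1)] euler_inequality[OF J(1)] ins by simp
  finally show ?thesis .
qed

text \<open>
  Distinct arcs share at most one point, so neither of the two can close up the other to a curve
  that separates.
\<close>

lemma connected_complement_two_arcs:
  assumes "i \<in> I" "j \<in> I"
  shows "connected (- (path_image (\<gamma> i) \<union> path_image (\<gamma> j)))"
proof (cases "i = j")
  case True
  then show ?thesis using connected_arc_complement[OF arcs[OF assms(1)]] by simp
next
  case False
  let ?S = "{pathstart (\<gamma> i), pathfinish (\<gamma> i)}" and ?T = "{pathstart (\<gamma> j), pathfinish (\<gamma> j)}"
  have "path_image (\<gamma> i) \<inter> path_image (\<gamma> j) = ?S \<inter> ?T"
    using disjoint[OF assms False] avoid[OF assms(1)] avoid[OF assms(2)] ends[OF assms(1)] ends[OF assms(2)]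
    unfolding path_image_ends_interior[of "\<gamma> i"] path_image_ends_interior[of "\<gamma> j"] by auto
  moreover have "?S \<noteq> ?T" using inj_onD[OF simple _ assms] False by blast
  then obtain x where "?S \<inter> ?T \<subseteq> {x}" using doubleton_Int_subset_singleton by metis
  then have "?S \<inter> ?T = {} \<or> ?S \<inter> ?T = {x}" by blast
  then have "connected (?S \<inter> ?T)" by auto
  ultimately show ?thesis
    by (intro Janiszewski_connected compact_arc compact_imp_closed assms)
       (auto intro!: connected_arc_complement arcs assms)
qed

text \<open>
  A face bordered by at most two arcs has its frontier in those arcs and the vertices.  Their
  complement is connected, so the face is all of it and no further arc can be present.
\<close>

lemma arcs_at_face:
  assumes U: "U \<in> components (- drawn I)" and three: "3 \<le> card I"
  shows "3 \<le> card {i \<in> I. closure U \<inter> \<gamma> i ` {0<..<1} \<noteq> {}}"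
proof (rule ccontr)
  define S where "S = {i \<in> I. closure U \<inter> \<gamma> i ` {0<..<1} \<noteq> {}}"
  have S: "S \<subseteq> I" "finite S" unfolding S_def using finite_I by auto
  assume "\<not> ?thesis"
  then have c: "card S \<le> 2" unfolding S_def by simp
  have "connected (- (\<Union>i\<in>S. path_image (\<gamma> i)))"
  proof (cases "S = {}")
    case False
    then obtain i where i: "i \<in> S" by blast
    have "\<exists>j \<in> S. S = {i, j}"
    proof (cases "S = {i}")
      case False
      then obtain j where j: "j \<in> S" "j \<noteq> i" using i by blast
      have "{i, j} = S" by (rule card_seteq) (use S i j c in auto)
      then show ?thesis using j by blast
    qed (use i in auto)
    then obtain j where "j \<in> S" "S = {i, j}" by blast
    then show ?thesis using connected_complement_two_arcs[of i j] i S(1) by auto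
  qed auto
  moreover have "open (- (\<Union>i\<in>S. path_image (\<gamma> i)))"
    using S compact_arc by (intro open_Compl compact_imp_closed compact_UN) auto
  ultimately have "connected (- (\<Union>i\<in>S. path_image (\<gamma> i)) - V)"
    by (intro connected_open_delete_finite finite_V) auto
  also have "- (\<Union>i\<in>S. path_image (\<gamma> i)) - V = - drawn S" unfolding drawn_def by blast
  finally have con: "connected (- drawn S)" .
  have "frontier U \<subseteq> drawn I"
    using frontier_of_components_closed_complement[OF _ U] compact_imp_closed[OF compact_drawn] by blast
  then have fr: "frontier U \<subseteq> drawn S"
    unfolding drawn_eq[OF order_refl] drawn_eq[OF S(1)] frontier_def unfolding S_def by auto
  have US: "U \<subseteq> - drawn I" "U \<noteq> {}"
    using in_components_subset[OF U] in_components_nonempty[OF U] by auto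
  have "- drawn S \<subseteq> U"
  proof (rule ccontr)
    assume "\<not> ?thesis"
    moreover have "- drawn S \<inter> U \<noteq> {}" using US S(1) unfolding drawn_def by blast
    ultimately show False using connected_Int_frontier[OF con, of U] fr by blast
  qed
  then have sub: "drawn I \<subseteq> drawn S" using US by blast
  obtain j where "j \<in> I - S"
    using c three S card_mono[OF S(2), of I] by fastforce
  then have "\<gamma> j ` {0<..<1} \<subseteq> drawn I"
    unfolding drawn_eq[OF order_refl] by auto
  then have "\<gamma> j ` {0<..<1} = {}"
    using interior_arc_disjoint_drawn[OF S(1) \<open>j \<in> I - S\<close>] sub by blast
  then show False by simp
qed

text \<open>
  Double counting of incidences between faces and arcs, combined with Euler's inequality.
\<close>

theorem card_arcs_le: "card I \<le> 3 * card V"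
proof (cases "3 \<le> card I")
  case True
  let ?F = "components (- drawn I)" and ?at = "\<lambda>U i. closure U \<inter> \<gamma> i ` {0<..<1} \<noteq> {}"
  have "3 * card ?F = (\<Sum>U\<in>?F. 3)" by simp
  also have "\<dots> \<le> (\<Sum>U\<in>?F. card {i \<in> I. ?at U i})"
    by (intro sum_mono arcs_at_face True)
  also have "\<dots> = (\<Sum>i\<in>I. card {U \<in> ?F. ?at U i})"
    by (rule sum_multicount_gen) (use finite_faces finite_I in auto)
  also have "\<dots> \<le> (\<Sum>i\<in>I. 2)"
    by (intro sum_mono faces_at_arc)
  finally have "3 * card ?F \<le> 2 * card I" by simp
  moreover have "card I + 1 \<le> card ?F + card V"
    using euler_inequality[OF order_refl] by auto
  ultimately show ?thesis by linarith
next
  case False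
  show ?thesis
  proof (cases "I = {}")
    case False
    then have "V \<noteq> {}" using ends by blast
    then have "1 \<le> card V" using finite_V by (simp add: Suc_le_eq card_gt_0_iff)
    then show ?thesis using \<open>\<not> 3 \<le> card I\<close> by linarith
  qed auto
qed

end

section \<open>Drawings on the Klein bottle\<close>

text \<open>
  The torus of all \<open>(v, s + k \<i>)\<close> with both entries of norm 1, modulo the free
  involution \<open>(v, s + k \<i>) \<mapsto> (- v, s - k \<i>)\<close>, embedded by the
  invariant functions \<open>v\<^sup>2\<close>, \<open>s\<close> and \<open>k v\<close>.
\<close>

definition klein_bottle :: "(complex \<times> real \<times> complex) set" where
  "klein_bottle = {(v\<^sup>2, s, k *\<^sub>R v) | v s k. norm v = 1 \<and> s\<^sup>2 + k\<^sup>2 = 1}"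

definition klein_cover :: "complex \<Rightarrow> complex \<times> real \<times> complex" where
  "klein_cover z =
    (cis (2 * pi * Re z), cos (2 * pi * Im z), sin (2 * pi * Im z) *\<^sub>R cis (pi * Re z))"

text \<open>
  The deck transformations of \<open>klein_cover\<close>: translations, and glide reflections
  when \<open>m\<close> is odd.
\<close>

definition deck :: "int \<Rightarrow> int \<Rightarrow> complex \<Rightarrow> complex" where
  "deck m n z = (if even m then z else cnj z) + Complex (of_int m) (of_int n)"

lemma continuous_on_deck: "continuous_on S (deck m n)"
  unfolding deck_def by (cases "even m") (auto intro!: continuous_intros)

lemma deck_deck: "deck m n (deck k l z) = deck (m + k) (n + (if even m then l else - l)) z"
  by (auto simp: deck_def complex_eq_iff)

lemma deck_eq_iff: "deck m n z = deck m' n' z \<longleftrightarrow> m = m' \<and> n = n'"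
  by (auto simp: deck_def complex_eq_iff)

lemma klein_cover_deck: "klein_cover (deck m n z) = klein_cover z"
proof -
  have c: "cis (2 * pi * (Re z + of_int m)) = cis (2 * pi * Re z)"
    using cis_multiple_2pi[of "of_int m"] by (simp add: distrib_left flip: cis_mult)
  have p: "cis (pi * (Re z + of_int m)) = (if even m then 1 else -1) * cis (pi * Re z)"
  proof -
    have "cis (pi * of_int m) = (if even m then 1 else -1)"
      by (simp add: complex_eq_iff cos_npi_int sin_npi_int del: mult_minus_right)
    then show ?thesis by (simp add: distrib_left mult.commute flip: cis_mult)
  qed
  have s: "cos (2 * pi * (y + of_int n)) = cos (2 * pi * y)" "sin (2 * pi * (y + of_int n)) = sin (2 * pi * y)" for y
    using cis_multiple_2pi[of "of_int n"]
    by (simp_all add: distrib_left cos_add sin_add complex_eq_iff)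
  show ?thesis
  proof (cases "even m")
    case True
    then show ?thesis using c p s unfolding klein_cover_def deck_def by simp
  next
    case False
    then show ?thesis using c p s[of "- Im z"] unfolding klein_cover_def deck_def by simp
  qed
qed

text \<open>
  The first coordinate determines \<open>Re z\<close> up to an integer \<open>m\<close>.  After
  correction by a deck transformation the real parts agree, and then the remaining coordinates
  determine \<open>Im z\<close> up to an integer.
\<close>

lemma klein_cover_eqD:
  assumes "klein_cover z = klein_cover w"
  obtains m n where "w = deck m n z"
proof -
  have eq: "cis (2 * pi * Re z) = cis (2 * pi * Re w)" "cos (2 * pi * Im z) = cos (2 * pi * Im w)"
    "sin (2 * pi * Im z) *\<^sub>R cis (pi * Re z) = sin (2 * pi * Im w) *\<^sub>R cis (pi * Re w)"
    using assms unfolding klein_cover_def by auto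
  have lattice: "\<exists>m::int. b = a + of_int m" if "cis (2 * pi * a) = cis (2 * pi * b)" for a b
  proof -
    have "sin (2 * pi * a) = sin (2 * pi * b)" "cos (2 * pi * a) = cos (2 * pi * b)"
      using that by (auto simp: complex_eq_iff)
    then obtain m :: int where "2 * pi * a = 2 * pi * b + 2 * pi * of_int m"
      using sin_cos_eq_iff[of "2 * pi * a" "2 * pi * b"] by auto
    then have "2 * pi * a = 2 * pi * (b + of_int m)" by (simp add: distrib_left)
    then have "a = b + of_int m" by (simp only: mult_cancel_left) simp
    then show ?thesis by (intro exI[of _ "- m"]) simp
  qed
  obtain m where m: "Re w = Re z + of_int m" using lattice[OF eq(1)] by blast
  have Re: "Re (deck m 0 z) = Re w"
    unfolding deck_def m by auto
  have "klein_cover (deck m 0 z) = klein_cover w" using assms klein_cover_deck by simp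
  then have "cos (2 * pi * Im (deck m 0 z)) = cos (2 * pi * Im w)"
    "sin (2 * pi * Im (deck m 0 z)) = sin (2 * pi * Im w)"
    unfolding klein_cover_def Re by auto
  then have "cis (2 * pi * Im (deck m 0 z)) = cis (2 * pi * Im w)"
    by (simp add: complex_eq_iff)
  then obtain n where n: "Im w = Im (deck m 0 z) + of_int n" using lattice by blast
  have "w = deck m n z"
    using n m unfolding deck_def by (auto simp: complex_eq_iff)
  then show thesis by (rule that)
qed

lemma circle_path_lift:
  fixes f :: "real \<Rightarrow> complex"
  assumes "continuous_on {0..1} f" "\<And>t. t \<in> {0..1} \<Longrightarrow> norm (f t) = 1"
  obtains \<theta> where "continuous_on {0..1} \<theta>" "\<And>t. t \<in> {0..1} \<Longrightarrow> f t = cis (2 * pi * \<theta> t)"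
proof -
  have "f t \<noteq> 0" if "t \<in> {0..1}" for t using assms(2)[OF that] by auto
  then obtain l where l: "continuous_on {0..1} l" "\<And>t. t \<in> {0..1} \<Longrightarrow> f t = exp (l t)"
    using continuous_logarithm_on_contractible[OF assms(1)] convex_imp_contractible
    by (metis convex_real_interval(5))
  show thesis
  proof
    show "continuous_on {0..1} (\<lambda>t. Im (l t) / (2 * pi))"
      using l(1) by (intro continuous_intros) auto
    fix t :: real assume t: "t \<in> {0..1}"
    have "exp (Re (l t)) = 1" using assms(2)[OF t] l(2)[OF t] by simp
    then have "exp (l t) = cis (Im (l t))" by (simp add: exp_eq_polar)
    then show "f t = cis (2 * pi * (Im (l t) / (2 * pi)))" using l(2)[OF t] by simp
  qed
qed

text \<open>
  Two continuous logarithms.  The first coordinate lifts to \<open>x\<close>; multiplying the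
  last coordinate by \<open>cis (- pi x)\<close> then makes it real, and together with the
  middle coordinate it traces a path on the unit circle, which lifts to \<open>y\<close>.
\<close>

lemma klein_path_lift:
  assumes "path g" "path_image g \<subseteq> klein_bottle"
  obtains h where "path h" "\<And>t. t \<in> {0..1} \<Longrightarrow> klein_cover (h t) = g t"
proof -
  have cont: "continuous_on {0..1} g" using assms(1) unfolding path_def .
  have g: "\<exists>v s k. g t = (v\<^sup>2, s, k *\<^sub>R v) \<and> norm v = 1 \<and> s\<^sup>2 + k\<^sup>2 = 1" if "t \<in> {0..1}" for t
    using assms(2) that unfolding klein_bottle_def path_image_def by blast
  have "continuous_on {0..1} (\<lambda>t. fst (g t))" by (intro continuous_intros cont)
  moreover have "norm (fst (g t)) = 1" if "t \<in> {0..1}" for t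
    using g[OF that] by (auto simp: norm_power)
  ultimately obtain x where x: "continuous_on {0..1} x" "\<And>t. t \<in> {0..1} \<Longrightarrow> fst (g t) = cis (2 * pi * x t)"
    using circle_path_lift by blast
  define c where "c t = snd (snd (g t)) * cis (- (pi * x t))" for t
  have c: "\<exists>k. c t = of_real k \<and> (fst (snd (g t)))\<^sup>2 + k\<^sup>2 = 1" if t: "t \<in> {0..1}" for t
  proof -
    obtain v s k where v: "g t = (v\<^sup>2, s, k *\<^sub>R v)" "norm v = 1" "s\<^sup>2 + k\<^sup>2 = 1" using g[OF t] by blast
    have "v\<^sup>2 = (cis (pi * x t))\<^sup>2"
      using x(2)[OF t] v(1) by (simp add: power2_eq_square cis_mult mult.assoc)
    then have "v = cis (pi * x t) \<or> v = - cis (pi * x t)" by (simp add: power2_eq_iff)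
    then have "c t = of_real k \<or> c t = of_real (- k)"
      unfolding c_def v(1) by (auto simp: scaleR_conv_of_real cis_mult)
    then show ?thesis using v by (metis fst_conv snd_conv power2_minus)
  qed
  have "continuous_on {0..1} c" unfolding c_def
    by (intro continuous_intros cont x)
  then have "continuous_on {0..1} (\<lambda>t. Complex (fst (snd (g t))) (Re (c t)))"
    by (auto simp: Complex_eq intro!: continuous_intros cont)
  moreover have "norm (Complex (fst (snd (g t))) (Re (c t))) = 1" if "t \<in> {0..1}" for t
    using c[OF that] by (auto simp: cmod_def)
  ultimately obtain y where y: "continuous_on {0..1} y"
    "\<And>t. t \<in> {0..1} \<Longrightarrow> Complex (fst (snd (g t))) (Re (c t)) = cis (2 * pi * y t)"
    using circle_path_lift by blast
  show thesis
  proof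
    show "path (\<lambda>t. Complex (x t) (y t))"
      unfolding path_def by (auto simp: Complex_eq intro!: continuous_intros x y)
    fix t :: real assume t: "t \<in> {0..1}"
    have "cos (2 * pi * y t) = fst (snd (g t))" "sin (2 * pi * y t) = Re (c t)"
      using y(2)[OF t] by (auto simp: complex_eq_iff)
    moreover have "of_real (Re (c t)) = c t" using c[OF t] by auto
    moreover have "c t * cis (pi * x t) = snd (snd (g t))"
      unfolding c_def by (simp add: mult.assoc cis_mult)
    ultimately show "klein_cover (Complex (x t) (y t)) = g t"
      using x(2)[OF t] by (simp add: klein_cover_def prod_eq_iff scaleR_conv_of_real)
  qed
qed

lemma quadratic_growth_le:
  fixes c d a :: nat
  assumes "\<And>N. c * N\<^sup>2 \<le> d * (N + a)\<^sup>2"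
  shows "c \<le> d"
proof (rule ccontr)
  assume "\<not> c \<le> d"
  (* large enough for d (2 a N + a^2) \<le> 3 d a N < N^2, where the first step needs a \<le> N *)
  define N where "N = 3 * d * a + 1"
  have "(d + 1) * N\<^sup>2 \<le> c * N\<^sup>2" using \<open>\<not> c \<le> d\<close> by (intro mult_right_mono) auto
  also have "\<dots> \<le> d * (N + a)\<^sup>2" by (rule assms)
  finally have le: "N * N \<le> d * (2 * a * N + a * a)"
    by (simp add: power2_eq_square algebra_simps)
  show False
  proof (cases "d = 0")
    case False
    then obtain d' where "d = Suc d'" by (cases d) auto
    then have "a \<le> N" unfolding N_def by (simp add: algebra_simps)
    then have "d * (2 * a * N + a * a) \<le> d * (2 * a * N + a * N)" by (intro mult_left_mono add_left_mono) auto
    also have "\<dots> = 3 * d * a * N" by (simp add: algebra_simps)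
    also have "\<dots> < N * N" unfolding N_def by simp
    finally show False using le by simp
  qed (use le N_def in simp)
qed

text \<open>
  All lifts of the drawing under the deck transformations with indices in an \<open>N \<times>
  N\<close> square form a plane drawing.  Their endpoints are lifts whose indices lie in a
  square larger by a constant \<open>D\<close>, which depends only on one chosen lift of each
  arc.  Dividing by \<open>N\<^sup>2\<close> gives the bound.
\<close>

theorem card_arcs_le_klein_bottle:
  fixes V :: "(complex \<times> real \<times> complex) set"
  assumes "arc_drawing V I \<gamma>"
    and kV: "V \<subseteq> klein_bottle" and kI: "\<And>i. i \<in> I \<Longrightarrow> path_image (\<gamma> i) \<subseteq> klein_bottle"
  shows "card I \<le> 3 * card V"
proof -
  interpret arc_drawing V I \<gamma> by fact
  have "\<exists>z. klein_cover z = v" if v: "v \<in> V" for v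
  proof -
    obtain h where "\<And>t. t \<in> {0..1} \<Longrightarrow> klein_cover (h t) = (\<lambda>_::real. v) t"
      by (rule klein_path_lift[of "\<lambda>_. v"]) (use v kV in \<open>auto simp: path_image_def path_def\<close>)
    then show ?thesis by (intro exI[of _ "h 0"]) simp
  qed
  then obtain l where l: "\<And>v. v \<in> V \<Longrightarrow> klein_cover (l v) = v" by metis
  have "\<exists>h. path h \<and> (\<forall>t \<in> {0..1}. klein_cover (h t) = \<gamma> i t)" if i: "i \<in> I" for i
    using klein_path_lift[OF arc_imp_path[OF arcs[OF i]] kI[OF i]] by metis
  then obtain h where h: "\<And>i. i \<in> I \<Longrightarrow> path (h i)"
    "\<And>i t. i \<in> I \<Longrightarrow> t \<in> {0..1} \<Longrightarrow> klein_cover (h i t) = \<gamma> i t" by metis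
  have end_V: "\<gamma> i t \<in> V" if "i \<in> I" "t \<in> {0, 1}" for i t
    using ends[OF that(1)] that(2) by (auto simp: pathstart_def pathfinish_def)
  have "\<exists>ab. h i t = deck (fst ab) (snd ab) (l (\<gamma> i t))" if "i \<in> I" "t \<in> {0, 1}" for i t
  proof -
    have "klein_cover (l (\<gamma> i t)) = klein_cover (h i t)"
      using h(2)[OF that(1), of t] l[OF end_V[OF that]] that(2) by auto
    then obtain m n where "h i t = deck m n (l (\<gamma> i t))" by (rule klein_cover_eqD)
    then show ?thesis by (intro exI[of _ "(m, n)"]) simp
  qed
  then obtain ab where ab: "\<And>i t. i \<in> I \<Longrightarrow> t \<in> {0, 1} \<Longrightarrow> h i t = deck (fst (ab i t)) (snd (ab i t)) (l (\<gamma> i t))"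
    by metis
  define D where "D = (\<Sum>i\<in>I. \<Sum>t\<in>{0,1::real}. nat \<bar>fst (ab i t)\<bar> + nat \<bar>snd (ab i t)\<bar>)"
  have D: "\<bar>fst (ab i t)\<bar> \<le> int D \<and> \<bar>snd (ab i t)\<bar> \<le> int D" if it: "i \<in> I" "t \<in> {0, 1}" for i t
  proof -
    have "nat \<bar>fst (ab i t)\<bar> + nat \<bar>snd (ab i t)\<bar> \<le> (\<Sum>t\<in>{0,1::real}. nat \<bar>fst (ab i t)\<bar> + nat \<bar>snd (ab i t)\<bar>)"
      using it(2) by (intro member_le_sum) auto
    also have "\<dots> \<le> D" unfolding D_def using it(1) finite_I by (intro member_le_sum) auto
    finally show ?thesis by linarith
  qed
  have "card I * N\<^sup>2 \<le> (3 * card V) * (N + 2 * D)\<^sup>2" for N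
  proof -
    (* the copies of the arcs with index in the square, and all vertices they can end in *)
    define I' where "I' = I \<times> {0..<int N} \<times> {0..<int N}"
    define \<gamma>' where "\<gamma>' = (\<lambda>(i, m, n) t. deck m n (h i t))"
    define V' where "V' = (\<lambda>(v, m, n). deck m n (l v)) `
      (V \<times> {- int D..<int N + int D} \<times> {- int D..<int N + int D})"
    have cover: "klein_cover (\<gamma>' (i, m, n) t) = \<gamma> i t" if "i \<in> I" "t \<in> {0..1}" for i m n t
      using h(2)[OF that] unfolding \<gamma>'_def by (simp add: klein_cover_deck)
    have inj: "s = t" if "i \<in> I" "s \<in> {0..1}" "t \<in> {0..1}" "\<gamma> i s = \<gamma> i t" for i s t
      using arcs[OF that(1)] that unfolding arc_def inj_on_def by blast
    have V'_cover: "klein_cover z \<in> V" if "z \<in> V'" for z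
      using that l unfolding V'_def by (auto simp: klein_cover_deck)
    have same: "m = m' \<and> n = n'" if "i \<in> I" "s \<in> {0..1}" "t \<in> {0..1}" "\<gamma>' (i, m, n) s = \<gamma>' (i, m', n') t"
      for i m n m' n' s t
    proof -
      have "s = t" using cover[of i s m n] cover[of i t m' n'] that inj by metis
      then show ?thesis using that(4) unfolding \<gamma>'_def by (simp add: deck_eq_iff)
    qed
    have "plane_drawing V' I' \<gamma>'"
      unfolding plane_drawing_def
    proof
      show "finite V'" "finite I'" unfolding V'_def I'_def using finite_V finite_I by auto
      fix e assume "e \<in> I'"
      then obtain i m n where e: "e = (i, m, n)" "i \<in> I" "0 \<le> m" "m < int N" "0 \<le> n" "n < int N"
        unfolding I'_def by auto
      show "arc (\<gamma>' e)" unfolding arc_def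
      proof
        show "path (\<gamma>' e)"
          using h(1)[OF e(2)] unfolding path_def e(1) \<gamma>'_def prod.case
          by (rule continuous_on_compose2[OF continuous_on_deck]) auto
        show "inj_on (\<gamma>' e) {0..1}"
          using cover[OF e(2)] inj[OF e(2)] unfolding e(1) inj_on_def by metis
      qed
      have "\<gamma>' e t \<in> V'" if t: "t \<in> {0, 1}" for t
      proof -
        let ?a = "fst (ab i t)" and ?b = "snd (ab i t)"
        have "\<gamma>' e t = deck (m + ?a) (n + (if even m then ?b else - ?b)) (l (\<gamma> i t))"
          unfolding e(1) \<gamma>'_def prod.case by (subst ab[OF e(2) t]) (rule deck_deck)
        moreover have "\<gamma> i t \<in> V" by (rule end_V[OF e(2) t])
        moreover have "m + ?a \<in> {- int D..<int N + int D}"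
          "n + (if even m then ?b else - ?b) \<in> {- int D..<int N + int D}"
          using D[OF e(2) t] e(3-) by auto
        ultimately show ?thesis
          unfolding V'_def by (intro image_eqI[of _ _ "(\<gamma> i t, m + ?a, n + (if even m then ?b else - ?b))"]) auto
      qed
      then show "{pathstart (\<gamma>' e), pathfinish (\<gamma>' e)} \<subseteq> V'"
        unfolding pathstart_def pathfinish_def by simp
      show "\<gamma>' e ` {0<..<1} \<inter> V' = {}"
      proof (rule ccontr)
        assume "\<not> ?thesis"
        then obtain t where t: "t \<in> {0<..<1}" "\<gamma>' e t \<in> V'" by blast
        then have "\<gamma> i t \<in> V" using cover[OF e(2), of t m n] V'_cover[of "\<gamma>' e t"] e(1) by simp
        then show False using avoid[OF e(2)] t(1) by blast
      qed
      fix f assume "f \<in> I'" "e \<noteq> f"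
      then obtain j m' n' where f: "f = (j, m', n')" "j \<in> I" unfolding I'_def by auto
      show "\<gamma>' e ` {0<..<1} \<inter> \<gamma>' f ` {0<..<1} = {}"
      proof (rule ccontr)
        assume "\<not> ?thesis"
        then obtain x where x: "x \<in> \<gamma>' e ` {0<..<1}" "x \<in> \<gamma>' f ` {0<..<1}" by blast
        obtain s where s: "s \<in> {0<..<1}" "x = \<gamma>' e s" using x(1) by (rule imageE)
        obtain t where t: "t \<in> {0<..<1}" "x = \<gamma>' f t" using x(2) by (rule imageE)
        note st = s(1) t(1) trans[OF s(2)[symmetric] t(2)]
        then have "\<gamma> i s = \<gamma> j t"
          using cover[OF e(2), of s m n] cover[OF f(2), of t m' n'] e(1) f(1) by simp
        then have "i = j" using disjoint[OF e(2) f(2)] st(1,2) by blast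
        then show False
          using same[OF e(2), of s t m n m' n'] st e(1) f(1) \<open>e \<noteq> f\<close> by simp
      qed
    next
      show "inj_on (\<lambda>e. {pathstart (\<gamma>' e), pathfinish (\<gamma>' e)}) I'"
      proof (rule inj_onI)
        fix e f assume ef: "e \<in> I'" "f \<in> I'" "{pathstart (\<gamma>' e), pathfinish (\<gamma>' e)} = {pathstart (\<gamma>' f), pathfinish (\<gamma>' f)}"
        obtain i m n where e: "e = (i, m, n)" "i \<in> I" using ef(1) unfolding I'_def by auto
        obtain j m' n' where f: "f = (j, m', n')" "j \<in> I" using ef(2) unfolding I'_def by auto
        have "klein_cover ` {\<gamma>' e 0, \<gamma>' e 1} = klein_cover ` {\<gamma>' f 0, \<gamma>' f 1}"
          using ef(3) unfolding pathstart_def pathfinish_def by simp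
        then have "{\<gamma> i 0, \<gamma> i 1} = {\<gamma> j 0, \<gamma> j 1}"
          using cover[OF e(2), of _ m n] cover[OF f(2), of _ m' n'] e(1) f(1) by simp
        then have ij: "i = j"
          using inj_onD[OF simple _ e(2) f(2)] by (simp add: pathstart_def pathfinish_def)
        obtain t where t: "t \<in> {0, 1}" "\<gamma>' e 0 = \<gamma>' f t"
          using ef(3) unfolding pathstart_def pathfinish_def by blast
        then have "m = m' \<and> n = n'"
          by (intro same[OF e(2), of 0 t]) (auto simp: e(1) f(1) ij)
        then show "e = f" using e f ij by simp
      qed
    qed
    then have "card I' \<le> 3 * card V'" by (rule plane_drawing.card_arcs_le)
    also have "card V' \<le> card (V \<times> {- int D..<int N + int D} \<times> {- int D..<int N + int D})"
      unfolding V'_def by (rule card_image_le) (use finite_V in auto)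
    also have "\<dots> = card V * (N + 2 * D)\<^sup>2"
      by (simp add: card_cartesian_product power2_eq_square nat_add_distrib nat_mult_distrib) (simp add: add.commute)
    finally show ?thesis unfolding I'_def by (simp add: card_cartesian_product power2_eq_square algebra_simps)
  qed
  then show ?thesis by (rule quadratic_growth_le)
qed

section \<open>From crosscap surfaces to subsets of Euclidean space\<close>

lemma (in arc_drawing) arc_drawing_image:
  assumes \<phi>: "continuous_on S \<phi>" "inj_on \<phi> S"
    and VS: "V \<subseteq> S" and IS: "\<And>i. i \<in> I \<Longrightarrow> path_image (\<gamma> i) \<subseteq> S"
  shows "arc_drawing (\<phi> ` V) I (\<lambda>i. \<phi> \<circ> \<gamma> i)"
proof -
  have int: "\<gamma> i ` {0<..<1} \<subseteq> S" if "i \<in> I" for i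
    using IS[OF that] path_image_ends_interior[of "\<gamma> i"] by auto
  have endsS: "{pathstart (\<gamma> i), pathfinish (\<gamma> i)} \<subseteq> S" if "i \<in> I" for i
    using ends[OF that] VS by blast
  show ?thesis
  proof
    show "finite (\<phi> ` V)" "finite I" using finite_V finite_I by auto
    fix i assume i: "i \<in> I"
    show "arc (\<phi> \<circ> \<gamma> i)"
      unfolding arc_def
    proof
      show "path (\<phi> \<circ> \<gamma> i)"
        by (rule path_continuous_image[OF arc_imp_path[OF arcs[OF i]] continuous_on_subset[OF \<phi>(1) IS[OF i]]])
      show "inj_on (\<phi> \<circ> \<gamma> i) {0..1}"
        using arcs[OF i] inj_on_subset[OF \<phi>(2) IS[OF i]] unfolding arc_def path_image_def
        by (auto intro: comp_inj_on)
    qed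
    show "{pathstart (\<phi> \<circ> \<gamma> i), pathfinish (\<phi> \<circ> \<gamma> i)} \<subseteq> \<phi> ` V"
      using ends[OF i] by (auto simp: pathstart_def pathfinish_def)
    have "\<phi> ` (\<gamma> i ` {0<..<1} \<inter> V) = \<phi> ` \<gamma> i ` {0<..<1} \<inter> \<phi> ` V"
      by (rule inj_on_image_Int[OF \<phi>(2) int[OF i] VS])
    then show "(\<phi> \<circ> \<gamma> i) ` {0<..<1} \<inter> \<phi> ` V = {}"
      unfolding avoid[OF i] image_comp by simp
    fix j assume j: "j \<in> I" "i \<noteq> j"
    have "\<phi> ` (\<gamma> i ` {0<..<1} \<inter> \<gamma> j ` {0<..<1}) = \<phi> ` \<gamma> i ` {0<..<1} \<inter> \<phi> ` \<gamma> j ` {0<..<1}"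
      by (rule inj_on_image_Int[OF \<phi>(2) int[OF i] int[OF j(1)]])
    then show "(\<phi> \<circ> \<gamma> i) ` {0<..<1} \<inter> (\<phi> \<circ> \<gamma> j) ` {0<..<1} = {}"
      unfolding disjoint[OF i j] image_comp by simp
  next
    show "inj_on (\<lambda>i. {pathstart (\<phi> \<circ> \<gamma> i), pathfinish (\<phi> \<circ> \<gamma> i)}) I"
    proof (rule inj_onI)
      fix i j assume ij: "i \<in> I" "j \<in> I"
        and "{pathstart (\<phi> \<circ> \<gamma> i), pathfinish (\<phi> \<circ> \<gamma> i)} = {pathstart (\<phi> \<circ> \<gamma> j), pathfinish (\<phi> \<circ> \<gamma> j)}"
      then have "\<phi> ` {pathstart (\<gamma> i), pathfinish (\<gamma> i)} = \<phi> ` {pathstart (\<gamma> j), pathfinish (\<gamma> j)}"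
        by (simp add: pathstart_def pathfinish_def)
      then have "{pathstart (\<gamma> i), pathfinish (\<gamma> i)} = {pathstart (\<gamma> j), pathfinish (\<gamma> j)}"
        using inj_on_image_eq_iff[OF \<phi>(2) endsS[OF ij(1)] endsS[OF ij(2)]] by blast
      then show "i = j" using inj_onD[OF simple _ ij] by blast
    qed
  qed
qed

lemma (in arc_drawing) arc_drawing_subset:
  assumes "J \<subseteq> I"
  shows "arc_drawing V J \<gamma>"
proof
  show "finite V" "finite J" using finite_V finite_I assms finite_subset by auto
  show "inj_on (\<lambda>i. {pathstart (\<gamma> i), pathfinish (\<gamma> i)}) J" by (rule inj_on_subset[OF simple assms])
  fix i assume "i \<in> J"
  then have i: "i \<in> I" using assms by blast
  show "arc (\<gamma> i)" "{pathstart (\<gamma> i), pathfinish (\<gamma> i)} \<subseteq> V" "\<gamma> i ` {0<..<1} \<inter> V = {}"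
    by (fact arcs[OF i] ends[OF i] avoid[OF i])+
  fix j assume "j \<in> J" "i \<noteq> j"
  then show "\<gamma> i ` {0<..<1} \<inter> \<gamma> j ` {0<..<1} = {}"
    using disjoint[OF i] assms by blast
qed

text \<open>
  The points \<open>p\<close> and paths \<open>g\<close> are obtained before the map
  \<open>\<phi>\<close>, so that \<open>\<phi>\<close> may be chosen depending on the drawing.
\<close>

lemma drawable_on_arc_drawing:
  assumes G: "finite (vertices G)" "finite (edges G)" "\<And>e. e \<in> edges G \<Longrightarrow> e \<subseteq> vertices G"
    and "drawable_on G X"
  obtains p g where "p ` vertices G \<subseteq> topspace X" "\<forall>e \<in> edges G. g e ` {0..1} \<subseteq> topspace X"
    "\<forall>\<phi> :: 'p \<Rightarrow> 'q::t2_space. continuous_map X euclidean \<phi> \<and> inj_on \<phi> (topspace X) \<longrightarrow>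
      arc_drawing (\<phi> ` p ` vertices G) (edges G) (\<lambda>e. \<phi> \<circ> g e) \<and>
      card (\<phi> ` p ` vertices G) = card (vertices G)"
proof -
  obtain p g where p: "inj_on p (vertices G)" "p ` vertices G \<subseteq> topspace X"
    and all: "\<forall>e \<in> edges G. pathin X (g e) \<and> inj_on (g e) {0..1} \<and> {g e 0, g e 1} = p ` e \<and>
        g e ` {0<..<1} \<inter> p ` vertices G = {}"
      "\<forall>e \<in> edges G. \<forall>f \<in> edges G. e \<noteq> f \<longrightarrow> g e ` {0<..<1} \<inter> g f ` {0<..<1} = {}"
    using assms(4) unfolding drawable_on_def by (elim exE conjE) (rule that; assumption)
  have g: "pathin X (g e)" "inj_on (g e) {0..1}" "{g e 0, g e 1} = p ` e"
      "g e ` {0<..<1} \<inter> p ` vertices G = {}" if "e \<in> edges G" for e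
    using bspec[OF all(1) that] by auto
  have disj: "g e ` {0<..<1} \<inter> g f ` {0<..<1} = {}" if "e \<in> edges G" "f \<in> edges G" "e \<noteq> f" for e f
    using all(2) that by blast
  have top: "g e ` {0..1} \<subseteq> topspace X" if "e \<in> edges G" for e
    using g(1)[OF that] unfolding pathin_def by (auto simp: continuous_map_def)
  have top': "g e ` {0<..<1} \<subseteq> topspace X" if "e \<in> edges G" for e
    using top[OF that] by auto
  show thesis
  proof (rule that[OF p(2)])
    show "\<forall>e \<in> edges G. g e ` {0..1} \<subseteq> topspace X" using top by blast
    show "\<forall>\<phi> :: 'p \<Rightarrow> 'q::t2_space. continuous_map X euclidean \<phi> \<and> inj_on \<phi> (topspace X) \<longrightarrow>
      arc_drawing (\<phi> ` p ` vertices G) (edges G) (\<lambda>e. \<phi> \<circ> g e) \<and>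
      card (\<phi> ` p ` vertices G) = card (vertices G)"
    proof (intro allI impI, elim conjE)
      fix \<phi> :: "'p \<Rightarrow> 'q::t2_space" assume \<phi>: "continuous_map X euclidean \<phi>" "inj_on \<phi> (topspace X)"
      have "arc_drawing (\<phi> ` p ` vertices G) (edges G) (\<lambda>e. \<phi> \<circ> g e)"
      proof
        show "finite (\<phi> ` p ` vertices G)" "finite (edges G)" using G by auto
        fix e assume e: "e \<in> edges G"
        have "pathin euclidean (\<phi> \<circ> g e)" by (rule pathin_compose[OF g(1)[OF e] \<phi>(1)])
        moreover have "inj_on (\<phi> \<circ> g e) {0..1}"
          using comp_inj_on[OF g(2)[OF e]] inj_on_subset[OF \<phi>(2) top[OF e]] by blast
        ultimately show "arc (\<phi> \<circ> g e)" unfolding arc_def pathin_def path_def by simp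
        have "{g e 0, g e 1} \<subseteq> p ` vertices G" using g(3)[OF e] G(3)[OF e] by blast
        then show "{pathstart (\<phi> \<circ> g e), pathfinish (\<phi> \<circ> g e)} \<subseteq> \<phi> ` p ` vertices G"
          by (auto simp: pathstart_def pathfinish_def)
        have "\<phi> ` (g e ` {0<..<1} \<inter> p ` vertices G) = \<phi> ` g e ` {0<..<1} \<inter> \<phi> ` p ` vertices G"
          by (rule inj_on_image_Int[OF \<phi>(2) top'[OF e] p(2)])
        then show "(\<phi> \<circ> g e) ` {0<..<1} \<inter> \<phi> ` p ` vertices G = {}"
          unfolding g(4)[OF e] image_comp by simp
        fix f assume f: "f \<in> edges G" "e \<noteq> f"
        have "\<phi> ` (g e ` {0<..<1} \<inter> g f ` {0<..<1}) = \<phi> ` g e ` {0<..<1} \<inter> \<phi> ` g f ` {0<..<1}"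
          by (rule inj_on_image_Int[OF \<phi>(2) top'[OF e] top'[OF f(1)]])
        then show "(\<phi> \<circ> g e) ` {0<..<1} \<inter> (\<phi> \<circ> g f) ` {0<..<1} = {}"
          unfolding disj[OF e f] image_comp by simp
      next
        show "inj_on (\<lambda>e. {pathstart (\<phi> \<circ> g e), pathfinish (\<phi> \<circ> g e)}) (edges G)"
        proof (rule inj_onI)
          fix e f assume ef: "e \<in> edges G" "f \<in> edges G"
            and "{pathstart (\<phi> \<circ> g e), pathfinish (\<phi> \<circ> g e)} = {pathstart (\<phi> \<circ> g f), pathfinish (\<phi> \<circ> g f)}"
          then have "\<phi> ` {g e 0, g e 1} = \<phi> ` {g f 0, g f 1}"
            by (simp add: pathstart_def pathfinish_def)
          then have eq: "\<phi> ` p ` e = \<phi> ` p ` f" unfolding g(3)[OF ef(1)] g(3)[OF ef(2)] .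
          have sub: "p ` e \<subseteq> topspace X" "p ` f \<subseteq> topspace X"
            using G(3)[OF ef(1)] G(3)[OF ef(2)] p(2) by auto
          have "p ` e = p ` f" using eq inj_on_image_eq_iff[OF \<phi>(2) sub] by blast
          then show "e = f"
            using inj_on_image_eq_iff[OF p(1) G(3)[OF ef(1)] G(3)[OF ef(2)]] by blast
        qed
      qed
      moreover have "inj_on (\<phi> \<circ> p) (vertices G)"
        using comp_inj_on[OF p(1)] inj_on_subset[OF \<phi>(2) p(2)] by blast
      then have "card (\<phi> ` p ` vertices G) = card (vertices G)"
        unfolding image_comp by (rule card_image)
      ultimately show "arc_drawing (\<phi> ` p ` vertices G) (edges G) (\<lambda>e. \<phi> \<circ> g e) \<and>
        card (\<phi> ` p ` vertices G) = card (vertices G)" ..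
    qed
  qed
qed

lemma crosscap_surface_embedding:
  fixes \<phi> :: "complex \<times> real \<Rightarrow> 'q::t2_space"
  assumes "continuous_on (holed_sphere k) \<phi>"
    and eq: "\<And>x y. \<lbrakk>x \<in> holed_sphere k; y \<in> holed_sphere k\<rbrakk> \<Longrightarrow>
      \<phi> x = \<phi> y \<longleftrightarrow> crosscap_class k x = crosscap_class k y"
  obtains \<Phi> where "continuous_map (crosscap_surface k) euclidean \<Phi>"
    "inj_on \<Phi> (topspace (crosscap_surface k))" "\<forall>x \<in> holed_sphere k. \<Phi> (crosscap_class k x) = \<phi> x"
    "topspace (crosscap_surface k) = crosscap_class k ` holed_sphere k"
proof -
  have q: "quotient_map (top_of_set (holed_sphere k)) (crosscap_surface k) (crosscap_class k)"
    unfolding crosscap_surface_def by (rule quotient_map_quotient_topology)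
  obtain \<Phi> where \<Phi>: "continuous_map (crosscap_surface k) euclidean \<Phi>"
    "\<And>x. x \<in> holed_sphere k \<Longrightarrow> \<Phi> (crosscap_class k x) = \<phi> x"
    by (rule quotient_map_lift_exists[OF q, of euclidean \<phi>]) (use assms in auto)
  have top: "topspace (crosscap_surface k) = crosscap_class k ` holed_sphere k"
    unfolding crosscap_surface_def topspace_quotient_topology by simp
  have "inj_on \<Phi> (topspace (crosscap_surface k))"
    unfolding top inj_on_def using \<Phi>(2) eq by auto
  then show thesis using that \<Phi> top by blast
qed

section \<open>The surface with two crosscaps\<close>

lemma inner_cap_centre_2:
  "x \<bullet> cap_centre 2 0 = Re (fst x)" "x \<bullet> cap_centre 2 1 = - Re (fst x)"
proof -
  have "(z, t) \<bullet> cap_centre 2 0 = Re z" "(z, t) \<bullet> cap_centre 2 1 = - Re z" for z :: complex and t :: real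
    by (simp_all add: cap_centre_def inner_complex_def)
  then show "x \<bullet> cap_centre 2 0 = Re (fst x)" "x \<bullet> cap_centre 2 1 = - Re (fst x)"
    by (metis prod.collapse)+
qed

lemma cos_cap_2: "cos (pi / (2 * real 2)) = sqrt 2 / 2"
  using cos_45 by simp

lemma holed_sphere_2:
  "x \<in> holed_sphere 2 \<longleftrightarrow> norm x = 1 \<and> \<bar>Re (fst x)\<bar> \<le> sqrt 2 / 2"
proof -
  have "(\<Union>i<2::nat. open_cap 2 i) = open_cap 2 0 \<union> open_cap 2 1"
    by (auto simp: less_2_cases_iff)
  then show ?thesis
    unfolding holed_sphere_def open_cap_def inner_cap_centre_2 cos_cap_2 by auto
qed

text \<open>
  The caps are centred at \<open>(1, 0)\<close> and \<open>(- 1, 0)\<close>, and the antipode on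
  either rim turns the sphere by half a turn about the axis through the two centres.
\<close>

lemma crosscap_class_2:
  assumes "x \<in> holed_sphere 2"
  shows "crosscap_class 2 x = crosscap_class 2 y \<longleftrightarrow>
    x = y \<or> \<bar>Re (fst x)\<bar> = sqrt 2 / 2 \<and> y = (cnj (fst x), - snd x)"
proof -
  have two: "(\<exists>i<2::nat. P i) \<longleftrightarrow> P 0 \<or> P 1" for P
    using less_2_cases_iff by auto
  have c: "cap_centre 2 0 = (1, 0)" "cap_centre 2 1 = (-1, 0)"
    by (simp_all add: cap_centre_def)
  have a: "rim_antipode 2 0 x = (cnj (fst x), - snd x)" "rim_antipode 2 1 x = (cnj (fst x), - snd x)"
    unfolding rim_antipode_def inner_cap_centre_2 unfolding c by (simp_all add: prod_eq_iff complex_eq_iff)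
  have n: "norm x = 1" using assms holed_sphere_2 by blast
  have r: "x \<in> cap_rim 2 0 \<longleftrightarrow> Re (fst x) = sqrt 2 / 2" "x \<in> cap_rim 2 1 \<longleftrightarrow> - Re (fst x) = sqrt 2 / 2"
    unfolding cap_rim_def inner_cap_centre_2 cos_cap_2 using n by auto
  have "\<bar>Re (fst x)\<bar> = sqrt 2 / 2 \<longleftrightarrow> Re (fst x) = sqrt 2 / 2 \<or> - Re (fst x) = sqrt 2 / 2"
    unfolding abs_eq_iff' by auto
  then show ?thesis
    unfolding crosscap_class_eq_iff two a r by blast
qed

text \<open>
  The sphere with two holes is a cylinder around the real axis of \<open>z\<close>, and
  \<open>u\<close> is the direction in which a point lies from that axis.  In the notation of
  \<open>klein_bottle\<close> it is mapped to \<open>v = u\<close>, \<open>s = \<surd>2 Re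
  z\<close> and \<open>k \<ge> 0\<close>; on the rims \<open>k = 0\<close>, so that exactly
  \<open>u\<close> and \<open>- u\<close> are identified there.
\<close>

definition crosscap2_to_klein :: "complex \<times> real \<Rightarrow> complex \<times> real \<times> complex" where
  "crosscap2_to_klein = (\<lambda>(z, t).
    let u = Complex (Im z) t /\<^sub>R sqrt (1 - (Re z)\<^sup>2)
    in (u\<^sup>2, sqrt 2 * Re z, sqrt (1 - 2 * (Re z)\<^sup>2) *\<^sub>R u))"

lemma norm_complex_real: "norm (z, t) = 1 \<longleftrightarrow> (Re z)\<^sup>2 + (Im z)\<^sup>2 + t\<^sup>2 = 1" for z :: complex and t :: real
  by (simp add: norm_prod_def cmod_power2)

lemma holed_sphere_2D:
  assumes "(z, t) \<in> holed_sphere 2"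
  shows "2 * (Re z)\<^sup>2 \<le> 1" "(Im z)\<^sup>2 + t\<^sup>2 = 1 - (Re z)\<^sup>2" "0 < 1 - (Re z)\<^sup>2"
proof -
  have *: "\<bar>Re z\<bar> \<le> sqrt 2 / 2" "(Re z)\<^sup>2 + (Im z)\<^sup>2 + t\<^sup>2 = 1"
    using assms unfolding holed_sphere_2 norm_complex_real by auto
  have "\<bar>Re z\<bar>\<^sup>2 \<le> (sqrt 2 / 2)\<^sup>2" using *(1) by (intro power_mono) auto
  then show "2 * (Re z)\<^sup>2 \<le> 1" by (simp add: power_divide)
  then show "0 < 1 - (Re z)\<^sup>2" by linarith
  show "(Im z)\<^sup>2 + t\<^sup>2 = 1 - (Re z)\<^sup>2" using *(2) by linarith
qed

lemma crosscap2_to_klein_in: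
  assumes "x \<in> holed_sphere 2"
  shows "crosscap2_to_klein x \<in> klein_bottle"
proof -
  obtain z t where x: "x = (z, t)" by (cases x)
  define r where "r = sqrt (1 - (Re z)\<^sup>2)"
  define u where "u = Complex (Im z) t /\<^sub>R r"
  note * = holed_sphere_2D[OF assms[unfolded x]]
  have r: "0 < r" "r\<^sup>2 = 1 - (Re z)\<^sup>2" unfolding r_def using *(3) by auto
  have "norm (Complex (Im z) t) = r" unfolding r_def complex_norm using *(2) by simp
  then have "norm u = 1" unfolding u_def using r(1) by simp
  moreover have "(sqrt 2 * Re z)\<^sup>2 + (sqrt (1 - 2 * (Re z)\<^sup>2))\<^sup>2 = 1"
    using *(1) by (simp add: power_mult_distrib)
  ultimately show ?thesis
    unfolding klein_bottle_def x crosscap2_to_klein_def Let_def prod.case r_def[symmetric] u_def[symmetric] by blast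
qed

lemma crosscap2_to_klein_eq_iff:
  assumes "x \<in> holed_sphere 2" "y \<in> holed_sphere 2"
  shows "crosscap2_to_klein x = crosscap2_to_klein y \<longleftrightarrow> crosscap_class 2 x = crosscap_class 2 y"
proof -
  obtain z t where x: "x = (z, t)" by (cases x)
  obtain w s where y: "y = (w, s)" by (cases y)
  define r where "r = sqrt (1 - (Re z)\<^sup>2)"
  note X = holed_sphere_2D[OF assms(1)[unfolded x]] and Y = holed_sphere_2D[OF assms(2)[unfolded y]]
  have r: "r > 0" unfolding r_def using X(3) by auto
  have abs: "\<bar>Re z\<bar> = sqrt 2 / 2 \<longleftrightarrow> 2 * (Re z)\<^sup>2 = 1"
  proof
    assume "\<bar>Re z\<bar> = sqrt 2 / 2"
    then have "\<bar>Re z\<bar>\<^sup>2 = (sqrt 2 / 2)\<^sup>2" by (simp only:)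
    then show "2 * (Re z)\<^sup>2 = 1" by (simp add: power_divide)
  next
    assume "2 * (Re z)\<^sup>2 = 1"
    then have "\<bar>Re z\<bar>\<^sup>2 = (sqrt 2 / 2)\<^sup>2" by (simp add: power_divide)
    then show "\<bar>Re z\<bar> = sqrt 2 / 2" by (rule power2_eq_imp_eq) auto
  qed
  have "crosscap2_to_klein x = crosscap2_to_klein y \<longleftrightarrow>
    Re z = Re w \<and> (Complex (Im z) t = Complex (Im w) s \<or>
      Complex (Im z) t = - Complex (Im w) s \<and> 2 * (Re z)\<^sup>2 = 1)" (is "?L \<longleftrightarrow> ?R")
  proof (cases "Re z = Re w")
    case True
    let ?u = "Complex (Im z) t /\<^sub>R r" and ?v = "Complex (Im w) s /\<^sub>R r" and ?k = "sqrt (1 - 2 * (Re z)\<^sup>2)"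
    have "?L \<longleftrightarrow> ?u\<^sup>2 = ?v\<^sup>2 \<and> ?k *\<^sub>R ?u = ?k *\<^sub>R ?v"
      unfolding x y crosscap2_to_klein_def Let_def prod.case True[symmetric] r_def[symmetric] by auto
    also have "\<dots> \<longleftrightarrow> (?u = ?v \<or> ?u = - ?v) \<and> (?k = 0 \<or> ?u = ?v)"
      unfolding power2_eq_iff by auto
    also have "\<dots> \<longleftrightarrow> ?u = ?v \<or> ?u = - ?v \<and> ?k = 0" by blast
    also have "?u = ?v \<longleftrightarrow> Complex (Im z) t = Complex (Im w) s" using r by simp
    also have "?u = - ?v \<longleftrightarrow> Complex (Im z) t = - Complex (Im w) s"
      using r unfolding scaleR_minus_right[symmetric] by (simp del: scaleR_minus_right)
    also have "?k = 0 \<longleftrightarrow> 2 * (Re z)\<^sup>2 = 1" by auto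
    finally show ?thesis using True by simp
  next
    case False
    then show ?thesis unfolding x y crosscap2_to_klein_def Let_def by simp
  qed
  also have "\<dots> \<longleftrightarrow> crosscap_class 2 x = crosscap_class 2 y"
    using crosscap_class_2[OF assms(1), of y] unfolding x y fst_conv snd_conv abs
    by (auto simp: complex_eq_iff)
  finally show ?thesis .
qed

lemma continuous_on_crosscap2_to_klein: "continuous_on (holed_sphere 2) crosscap2_to_klein"
proof -
  have "sqrt (1 - (Re (fst x))\<^sup>2) \<noteq> 0" if "x \<in> holed_sphere 2" for x
    using holed_sphere_2D(3)[of "fst x" "snd x"] that by simp
  then show ?thesis
    unfolding crosscap2_to_klein_def Let_def case_prod_beta Complex_eq
    by (intro continuous_intros) auto
qed

theorem card_edges_le_crosscap_2:
  assumes "finite (vertices G)" "finite (edges G)" "\<And>e. e \<in> edges G \<Longrightarrow> e \<subseteq> vertices G"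
    and "drawable_on G (crosscap_surface 2)"
  shows "card (edges G) \<le> 3 * card (vertices G)"
proof -
  obtain \<Phi> where \<Phi>: "continuous_map (crosscap_surface 2) euclidean \<Phi>"
    "inj_on \<Phi> (topspace (crosscap_surface 2))" "\<forall>x \<in> holed_sphere 2. \<Phi> (crosscap_class 2 x) = crosscap2_to_klein x"
    "topspace (crosscap_surface 2) = crosscap_class 2 ` holed_sphere 2"
    by (rule crosscap_surface_embedding[OF continuous_on_crosscap2_to_klein crosscap2_to_klein_eq_iff])
  obtain p g where pg: "p ` vertices G \<subseteq> topspace (crosscap_surface 2)"
    "\<forall>e \<in> edges G. g e ` {0..1} \<subseteq> topspace (crosscap_surface 2)"
    "\<forall>\<phi> :: _ \<Rightarrow> complex \<times> real \<times> complex.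
      continuous_map (crosscap_surface 2) euclidean \<phi> \<and> inj_on \<phi> (topspace (crosscap_surface 2)) \<longrightarrow>
      arc_drawing (\<phi> ` p ` vertices G) (edges G) (\<lambda>e. \<phi> \<circ> g e) \<and>
      card (\<phi> ` p ` vertices G) = card (vertices G)"
    by (rule drawable_on_arc_drawing[OF assms])
  have sub: "\<Phi> ` topspace (crosscap_surface 2) \<subseteq> klein_bottle"
    unfolding \<Phi>(4) using \<Phi>(3) crosscap2_to_klein_in by auto
  have "card (edges G) \<le> 3 * card (\<Phi> ` p ` vertices G)"
  proof (rule card_arcs_le_klein_bottle)
    show "arc_drawing (\<Phi> ` p ` vertices G) (edges G) (\<lambda>e. \<Phi> \<circ> g e)" using pg(3) \<Phi>(1,2) by blast
    show "\<Phi> ` p ` vertices G \<subseteq> klein_bottle" using sub pg(1) by blast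
    show "path_image (\<Phi> \<circ> g e) \<subseteq> klein_bottle" if "e \<in> edges G" for e
      using sub pg(2) that unfolding path_image_def image_comp[symmetric] by blast
  qed
  then show ?thesis using pg(3) \<Phi>(1,2) by simp
qed

section \<open>The surface with one crosscap\<close>

text \<open>
  The reflection in the hyperplane orthogonal to \<open>n\<close>, and the identity if \<open>n
  = 0\<close>.
\<close>

definition reflection_along :: "'a::real_inner \<Rightarrow> 'a \<Rightarrow> 'a" where
  "reflection_along n x = x - (2 * (x \<bullet> n) / (n \<bullet> n)) *\<^sub>R n"

lemma norm_reflection_along: "norm (reflection_along n x) = norm x"
proof (cases "n = 0")
  case False
  then have n: "n \<bullet> n \<noteq> 0" by simp
  let ?c = "2 * (x \<bullet> n) / (n \<bullet> n)"
  have "reflection_along n x \<bullet> reflection_along n x = x \<bullet> x - 2 * ?c * (x \<bullet> n) + ?c * (?c * (n \<bullet> n))"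
    unfolding reflection_along_def
    by (simp add: inner_diff_left inner_diff_right inner_commute algebra_simps)
  also have "?c * (n \<bullet> n) = 2 * (x \<bullet> n)" using n by simp
  finally show ?thesis by (simp add: norm_eq_sqrt_inner)
qed (simp add: reflection_along_def)

lemma reflection_along_involution: "reflection_along n (reflection_along n x) = x"
proof (cases "n = 0")
  case False
  then have n: "n \<bullet> n \<noteq> 0" by simp
  have "reflection_along n x \<bullet> n = - (x \<bullet> n)"
    unfolding reflection_along_def using n by (simp add: inner_diff_left)
  then show ?thesis
    unfolding reflection_along_def[of n "reflection_along n x"] by (simp add: reflection_along_def)
qed (simp add: reflection_along_def)

lemma reflection_along_uminus: "reflection_along n (- x) = - reflection_along n x"
  by (simp add: reflection_along_def)

lemma reflection_along_eq_iff: "reflection_along n x = reflection_along n y \<longleftrightarrow> x = y"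
  by (metis reflection_along_involution)

lemma reflection_along_swap:
  assumes "norm x = norm y"
  shows "reflection_along (x - y) x = y"
proof (cases "x = y")
  case False
  have "x \<bullet> x = y \<bullet> y" using assms by (simp add: norm_eq)
  then have "2 * (x \<bullet> (x - y)) = (x - y) \<bullet> (x - y)"
    by (simp add: inner_diff_left inner_diff_right inner_commute)
  moreover have "(x - y) \<bullet> (x - y) \<noteq> 0" using False by simp
  ultimately show ?thesis by (simp add: reflection_along_def)
qed (simp add: reflection_along_def)

lemma continuous_on_reflection_along: "continuous_on S (reflection_along n)"
  unfolding reflection_along_def divide_inverse by (intro continuous_intros)

text \<open>
  The cap has angular radius \<open>pi / 2\<close>, so the holed sphere is a closed hemisphere
  and its rim is a great circle, with the usual antipodes.
\<close>

lemma holed_sphere_1: "x \<in> holed_sphere 1 \<longleftrightarrow> norm x = 1 \<and> Re (fst x) \<le> 0"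
  and crosscap_class_1: "\<lbrakk>x \<in> holed_sphere 1; y \<in> holed_sphere 1\<rbrakk> \<Longrightarrow>
    crosscap_class 1 x = crosscap_class 1 y \<longleftrightarrow> x = y \<or> y = - x"
proof -
  have c: "cap_centre 1 0 = (1, 0)" by (simp add: cap_centre_def)
  have inner: "x \<bullet> cap_centre 1 0 = Re (fst x)" for x
    unfolding c by (simp add: inner_prod_def inner_complex_def)
  have cos: "cos (pi / (2 * real 1)) = 0" by simp
  show h: "x \<in> holed_sphere 1 \<longleftrightarrow> norm x = 1 \<and> Re (fst x) \<le> 0" for x
  proof -
    have "(\<Union>i<1::nat. open_cap 1 i) = open_cap 1 0" by auto
    moreover have "open_cap 1 0 = {x. norm x = 1 \<and> Re (fst x) > 0}"
      unfolding open_cap_def inner cos by auto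
    ultimately show ?thesis unfolding holed_sphere_def by auto
  qed
  assume xy: "x \<in> holed_sphere 1" "y \<in> holed_sphere 1"
  have r: "x \<in> cap_rim 1 0 \<longleftrightarrow> Re (fst x) = 0"
    unfolding cap_rim_def inner cos using xy h by auto
  have one: "(\<exists>i<1::nat. P i) \<longleftrightarrow> P 0" for P by auto
  have "Re (fst x) = 0 \<Longrightarrow> rim_antipode 1 0 x = - x"
    unfolding rim_antipode_def inner by simp
  moreover have "y = - x \<Longrightarrow> Re (fst x) = 0" using xy h by auto
  ultimately show "crosscap_class 1 x = crosscap_class 1 y \<longleftrightarrow> x = y \<or> y = - x"
    unfolding crosscap_class_eq_iff one r by metis
qed

text \<open>
  The unit sphere modulo antipodes, embedded by the even functions \<open>z\<^sup>2\<close> and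
  \<open>t z\<close>; the poles give the point \<open>(0, 0)\<close>.
\<close>

definition projective_plane :: "(complex \<times> complex) set" where
  "projective_plane = {(z\<^sup>2, t *\<^sub>R z) | z t. norm (z, t :: real) = 1}"

definition to_projective_plane :: "complex \<times> real \<Rightarrow> complex \<times> complex" where
  "to_projective_plane x = ((fst x)\<^sup>2, snd x *\<^sub>R fst x)"

lemma to_projective_plane_eq_iff:
  assumes "norm x = 1" "norm y = 1"
  shows "to_projective_plane x = to_projective_plane y \<longleftrightarrow> x = y \<or> y = - x"
proof
  obtain z t where x: "x = (z, t)" by (cases x)
  obtain w s where y: "y = (w, s)" by (cases y)
  assume "to_projective_plane x = to_projective_plane y"
  then have eq: "z\<^sup>2 = w\<^sup>2" "t *\<^sub>R z = s *\<^sub>R w" unfolding to_projective_plane_def x y by auto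
  have wz: "w = z \<or> w = - z" using eq(1) unfolding power2_eq_iff by auto
  show "x = y \<or> y = - x"
  proof (cases "z = 0")
    case True
    then have "w = 0" using eq(1) by simp
    then have "\<bar>t\<bar> = 1" "\<bar>s\<bar> = 1" using assms True unfolding x y by (auto simp: norm_Pair)
    then show ?thesis unfolding x y using True \<open>w = 0\<close> by auto
  next
    case False
    from wz show ?thesis
    proof
      assume "w = z"
      then show ?thesis using eq(2) False unfolding x y by simp
    next
      assume "w = - z"
      then have "t *\<^sub>R z = (- s) *\<^sub>R z" using eq(2) by simp
      then have "t = - s" using False scaleR_cancel_right by blast
      then show ?thesis using \<open>w = - z\<close> unfolding x y by simp
    qed
  qed
qed (auto simp: to_projective_plane_def)

text \<open>
  A point \<open>(z\<^sup>2, t z)\<close> with \<open>z \<noteq> 0\<close> is sent to the point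
  of the Klein bottle with \<open>v = z / |z|\<close>, \<open>s = |z|\<close> and \<open>k =
  t\<close>.
\<close>

definition projective_to_klein :: "complex \<times> complex \<Rightarrow> complex \<times> real \<times> complex" where
  "projective_to_klein = (\<lambda>(w, c). (w /\<^sub>R norm w, sqrt (norm w), c /\<^sub>R sqrt (norm w)))"

lemma projective_to_klein:
  defines "S \<equiv> {wc \<in> projective_plane. wc \<noteq> (0, 0)}"
  shows "continuous_on S projective_to_klein" "inj_on projective_to_klein S"
    "projective_to_klein ` S \<subseteq> klein_bottle"
proof -
  have ne: "fst wc \<noteq> 0" if "wc \<in> S" for wc
    using that unfolding S_def projective_plane_def by auto
  show "continuous_on S projective_to_klein"
    unfolding projective_to_klein_def case_prod_beta using ne by (intro continuous_intros) auto
  show "inj_on projective_to_klein S"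
  proof (rule inj_onI)
    fix a b assume ab: "a \<in> S" "b \<in> S" "projective_to_klein a = projective_to_klein b"
    then have n: "norm (fst a) = norm (fst b)" unfolding projective_to_klein_def case_prod_beta by simp
    then show "a = b"
      using ab ne[OF ab(2)] unfolding projective_to_klein_def case_prod_beta n by (simp add: prod_eq_iff)
  qed
  show "projective_to_klein ` S \<subseteq> klein_bottle"
  proof
    fix y assume "y \<in> projective_to_klein ` S"
    then obtain wc where wc: "wc \<in> S" "y = projective_to_klein wc" by blast
    then obtain z t where z: "wc = (z\<^sup>2, t *\<^sub>R z)" "norm (z, t) = 1"
      unfolding S_def projective_plane_def by blast
    have "z \<noteq> 0" using ne[OF wc(1)] z(1) by auto
    let ?v = "z /\<^sub>R norm z"
    have "y = (?v\<^sup>2, norm z, t *\<^sub>R ?v)"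
      unfolding wc(2) z(1) projective_to_klein_def prod.case norm_power
      by (simp add: scaleR_power power_inverse mult.commute)
    moreover have "norm ?v = 1" using \<open>z \<noteq> 0\<close> by simp
    moreover have "(norm z)\<^sup>2 + t\<^sup>2 = 1" using z(2) by (simp add: norm_Pair)
    ultimately show "y \<in> klein_bottle" unfolding klein_bottle_def by blast
  qed
qed

text \<open>
  A reflection moves the midpoint of some edge \<open>d\<close> to the pole.  Without
  \<open>d\<close>, the drawing avoids the image \<open>(0, 0)\<close> of the pole and is
  transported to the Klein bottle.
\<close>

theorem card_edges_le_crosscap_1:
  assumes G: "finite (vertices G)" "finite (edges G)" "\<And>e. e \<in> edges G \<Longrightarrow> e \<subseteq> vertices G"
    and draw: "drawable_on G (crosscap_surface 1)"
  shows "card (edges G) \<le> 3 * card (vertices G) + 1"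
proof (cases "edges G = {}")
  case False
  then obtain d where d: "d \<in> edges G" by blast
  obtain p g where pg: "p ` vertices G \<subseteq> topspace (crosscap_surface 1)"
    "\<forall>e \<in> edges G. g e ` {0..1} \<subseteq> topspace (crosscap_surface 1)"
    "\<forall>\<phi> :: _ \<Rightarrow> complex \<times> complex.
      continuous_map (crosscap_surface 1) euclidean \<phi> \<and> inj_on \<phi> (topspace (crosscap_surface 1)) \<longrightarrow>
      arc_drawing (\<phi> ` p ` vertices G) (edges G) (\<lambda>e. \<phi> \<circ> g e) \<and>
      card (\<phi> ` p ` vertices G) = card (vertices G)"
    by (rule drawable_on_arc_drawing[OF assms])
  have "g d (1/2) \<in> g d ` {0..1}" by (rule imageI) simp
  then have "g d (1/2) \<in> topspace (crosscap_surface 1)" using pg(2) d by blast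
  then obtain m where m: "m \<in> holed_sphere 1" "g d (1/2) = crosscap_class 1 m"
    unfolding crosscap_surface_def topspace_quotient_topology by auto
  define r where "r = reflection_along (m - (0, 1))"
  have "r m = (0, 1)"
    unfolding r_def by (rule reflection_along_swap) (use m(1) holed_sphere_1 in \<open>auto simp: norm_Pair\<close>)
  define \<phi> where "\<phi> = to_projective_plane \<circ> r"
  have nr: "norm (r x) = norm x" for x unfolding r_def by (rule norm_reflection_along)
  have "continuous_on (holed_sphere 1) \<phi>"
    unfolding \<phi>_def r_def to_projective_plane_def
    by (intro continuous_on_compose continuous_on_reflection_along continuous_intros)
  moreover have "\<phi> x = \<phi> y \<longleftrightarrow> crosscap_class 1 x = crosscap_class 1 y"
    if xy: "x \<in> holed_sphere 1" "y \<in> holed_sphere 1" for x y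
  proof -
    have "\<phi> x = \<phi> y \<longleftrightarrow> r x = r y \<or> r y = - r x"
      unfolding \<phi>_def comp_apply by (rule to_projective_plane_eq_iff) (use xy holed_sphere_1 nr in auto)
    also have "\<dots> \<longleftrightarrow> x = y \<or> y = - x"
      unfolding r_def reflection_along_uminus[symmetric] reflection_along_eq_iff ..
    finally show ?thesis using crosscap_class_1[OF xy] by simp
  qed
  ultimately obtain \<Phi> where \<Phi>: "continuous_map (crosscap_surface 1) euclidean \<Phi>"
    "inj_on \<Phi> (topspace (crosscap_surface 1))" "\<forall>x \<in> holed_sphere 1. \<Phi> (crosscap_class 1 x) = \<phi> x"
    "topspace (crosscap_surface 1) = crosscap_class 1 ` holed_sphere 1"
    by (rule crosscap_surface_embedding)
  let ?V = "\<Phi> ` p ` vertices G" and ?E = "edges G - {d}" and ?\<gamma> = "\<lambda>e. \<Phi> \<circ> g e"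
  define S where "S = {wc \<in> projective_plane. wc \<noteq> (0, 0)}"
  have V: "arc_drawing ?V (edges G) ?\<gamma>" "card ?V = card (vertices G)"
    using pg(3) \<Phi>(1,2) by auto
  interpret G: arc_drawing ?V "edges G" ?\<gamma> by (fact V(1))
  interpret E: arc_drawing ?V ?E ?\<gamma> by (rule G.arc_drawing_subset) auto
  have img: "\<Phi> ` topspace (crosscap_surface 1) \<subseteq> projective_plane"
  proof -
    have "\<phi> x \<in> projective_plane" if "x \<in> holed_sphere 1" for x
      using that holed_sphere_1 nr[of x]
      unfolding \<phi>_def projective_plane_def to_projective_plane_def comp_apply by (auto intro!: exI[of _ "snd (r x)"])
    then show ?thesis unfolding \<Phi>(4) using \<Phi>(3) by auto
  qed
  have centre: "?\<gamma> d (1/2) = (0, 0)"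
    using \<Phi>(3) m \<open>r m = (0, 1)\<close> by (simp add: \<phi>_def to_projective_plane_def)
  then have c: "(0, 0) \<in> ?\<gamma> d ` {0<..<1}" by (intro image_eqI[of _ _ "1/2"]) auto
  have VS: "?V \<subseteq> S"
    using G.avoid[OF d] c img pg(1) unfolding S_def by blast
  have ES: "path_image (?\<gamma> e) \<subseteq> S" if "e \<in> ?E" for e
  proof -
    have "path_image (?\<gamma> e) \<subseteq> projective_plane"
      using img pg(2) that unfolding path_image_def image_comp[symmetric] by blast
    moreover have "(0, 0) \<notin> ?\<gamma> e ` {0<..<1}"
      using G.disjoint[OF d, of e] that c by blast
    moreover have "{pathstart (?\<gamma> e), pathfinish (?\<gamma> e)} \<subseteq> S" using E.ends[OF that] VS by blast
    ultimately show ?thesis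
      unfolding path_image_ends_interior[of "?\<gamma> e"] S_def by blast
  qed
  note K = projective_to_klein[folded S_def]
  have "card ?E \<le> 3 * card (projective_to_klein ` ?V)"
  proof (rule card_arcs_le_klein_bottle)
    show "arc_drawing (projective_to_klein ` ?V) ?E (\<lambda>e. projective_to_klein \<circ> ?\<gamma> e)"
      by (rule E.arc_drawing_image[OF K(1,2) VS ES])
    show "projective_to_klein ` ?V \<subseteq> klein_bottle" using K(3) VS by blast
    show "path_image (projective_to_klein \<circ> ?\<gamma> e) \<subseteq> klein_bottle" if "e \<in> ?E" for e
      using K(3) ES[OF that] unfolding path_image_def image_comp[symmetric] by blast
  qed
  also have "card (projective_to_klein ` ?V) \<le> card ?V" by (rule card_image_le) (rule G.finite_V)
  finally show ?thesis using V(2) d G(2) by (simp add: card_Diff_singleton)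
qed simp

section \<open>Drawings with great circle arcs\<close>

text \<open>
  Vertices are unit vectors at pairwise angles of at least a right angle, and edges are quarters
  of great circles.  The arcs do not cross because a point of the sphere reveals the edge or
  vertex it lies on: it has positive inner product exactly with the endpoints of that edge, or
  with that vertex alone.
\<close>

lemma drawable_on_sphere:
  fixes pos :: "'v \<Rightarrow> complex \<times> real"
  assumes unit: "\<And>v. v \<in> vertices G \<Longrightarrow> norm (pos v) = 1"
    and obtuse: "\<And>u v. \<lbrakk>u \<in> vertices G; v \<in> vertices G; u \<noteq> v\<rbrakk> \<Longrightarrow> pos u \<bullet> pos v \<le> 0"
    and edge: "\<And>e. e \<in> edges G \<Longrightarrow>
      \<exists>u v. e = {u, v} \<and> u \<in> vertices G \<and> v \<in> vertices G \<and> u \<noteq> v \<and> pos u \<bullet> pos v = 0"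
  shows "drawable_on G (crosscap_surface 0)"
proof -
  have class0: "crosscap_class 0 = (\<lambda>x. {x})" unfolding crosscap_class_def by auto
  have holed0: "holed_sphere 0 = sphere 0 1" unfolding holed_sphere_def by simp
  have cont: "continuous_map (top_of_set (sphere 0 1)) (crosscap_surface 0) (\<lambda>x. {x})"
    using quotient_imp_continuous_map[OF quotient_map_quotient_topology[of "top_of_set (holed_sphere 0)" "crosscap_class 0"]]
    unfolding crosscap_surface_def class0 holed0 .
  have top: "topspace (crosscap_surface 0) = (\<lambda>x. {x}) ` sphere 0 1"
    unfolding crosscap_surface_def topspace_quotient_topology class0 holed0 by simp
  obtain a b where ab: "\<And>e. e \<in> edges G \<Longrightarrow> e = {a e, b e} \<and> a e \<in> vertices G \<and> b e \<in> vertices G \<and> a e \<noteq> b e \<and>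
    pos (a e) \<bullet> pos (b e) = 0"
    using edge by metis
  define c where "c e t = cos (pi / 2 * t) *\<^sub>R pos (a e) + sin (pi / 2 * t) *\<^sub>R pos (b e)" for e t
  (* pull recovers the vertex or edge that a point of the drawing lies on *)
  define pull where "pull x = {v \<in> vertices G. x \<bullet> pos v > 0}" for x
  have self: "pos v \<bullet> pos v = 1" if "v \<in> vertices G" for v
    using unit[OF that] by (simp add: norm_eq_1)
  have pull_pos: "pull (pos v) = {v}" if "v \<in> vertices G" for v
    unfolding pull_def using that obtuse[OF that] self[OF that] by (auto simp: not_le[symmetric])
  have inner_a: "c e t \<bullet> pos (a e) = cos (pi / 2 * t)" and inner_b: "c e t \<bullet> pos (b e) = sin (pi / 2 * t)"
    and inner_c: "c e t \<bullet> c e t = 1" if "e \<in> edges G" for e t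
  proof -
    note E = ab[OF that]
    have "pos (b e) \<bullet> pos (a e) = 0" using E inner_commute by metis
    then show *: "c e t \<bullet> pos (a e) = cos (pi / 2 * t)" "c e t \<bullet> pos (b e) = sin (pi / 2 * t)"
      unfolding c_def using E self[of "a e"] self[of "b e"] by (simp_all add: inner_add_left)
    have "c e t \<bullet> c e t = cos (pi / 2 * t) * (c e t \<bullet> pos (a e)) + sin (pi / 2 * t) * (c e t \<bullet> pos (b e))"
      by (subst (2) c_def) (simp add: inner_add_right)
    then show "c e t \<bullet> c e t = 1" unfolding * by (simp flip: power2_eq_square)
  qed
  have pos_trig: "cos (pi / 2 * t) > 0" "sin (pi / 2 * t) > 0" if "t \<in> {0<..<1}" for t
  proof -
    have "0 < pi / 2 * t" "pi / 2 * t < pi / 2" using that by auto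
    then show "cos (pi / 2 * t) > 0" "sin (pi / 2 * t) > 0"
      by (intro cos_gt_zero sin_gt_zero; linarith)+
  qed
  have pull_c: "pull (c e t) = e" if e: "e \<in> edges G" and t: "t \<in> {0<..<1}" for e t
  proof -
    note E = ab[OF e]
    have "\<not> c e t \<bullet> pos v > 0" if v: "v \<in> vertices G" "v \<notin> e" for v
    proof -
      have "v \<noteq> a e" "v \<noteq> b e" using v(2) E by auto
      then have "pos (a e) \<bullet> pos v \<le> 0" "pos (b e) \<bullet> pos v \<le> 0" using E v(1) obtuse by auto
      then have "cos (pi / 2 * t) * (pos (a e) \<bullet> pos v) \<le> 0" "sin (pi / 2 * t) * (pos (b e) \<bullet> pos v) \<le> 0"
        using pos_trig[OF t] by (auto intro: mult_nonneg_nonpos)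
      then show ?thesis unfolding c_def by (simp add: inner_add_left)
    qed
    then have outside: "v \<notin> pull (c e t)" if "v \<notin> e" for v
      using that unfolding pull_def by blast
    have "a e \<in> pull (c e t)" "b e \<in> pull (c e t)"
      using inner_a[OF e] inner_b[OF e] pos_trig[OF t] E unfolding pull_def by auto
    then have "v \<in> pull (c e t)" if "v \<in> e" for v
    proof -
      have "v \<in> {a e, b e}"
        by (rule subst[OF conjunct1[OF E], of "\<lambda>S. v \<in> S"]) (rule that)
      then show ?thesis using \<open>a e \<in> pull (c e t)\<close> \<open>b e \<in> pull (c e t)\<close> by auto
    qed
    with outside show ?thesis by blast
  qed
  show ?thesis
    unfolding drawable_on_def
  proof (intro exI conjI ballI impI)
    show "inj_on (\<lambda>v. {pos v}) (vertices G)"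
      using pull_pos by (intro inj_onI) (metis singleton_inject)
    show "(\<lambda>v. {pos v}) ` vertices G \<subseteq> topspace (crosscap_surface 0)"
      unfolding top using unit by auto
    fix e assume e: "e \<in> edges G"
    note E = ab[OF e]
    have "continuous_on {0..1} (c e)" unfolding c_def by (intro continuous_intros)
    moreover have "c e t \<in> sphere 0 1" for t using inner_c[OF e] by (simp add: norm_eq_1)
    ultimately have "pathin (top_of_set (sphere 0 1)) (c e)"
      unfolding pathin_def by (auto simp: continuous_map_in_subtopology)
    then show "pathin (crosscap_surface 0) (\<lambda>t. {c e t})"
      using pathin_compose[OF _ cont] by (simp add: comp_def)
    show "inj_on (\<lambda>t. {c e t}) {0..1}"
    proof (rule inj_onI)
      fix s t :: real assume st: "s \<in> {0..1}" "t \<in> {0..1}" "{c e s} = {c e t}"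
      then have "c e s \<bullet> pos (a e) = c e t \<bullet> pos (a e)" by simp
      then have eq: "cos (pi / 2 * s) = cos (pi / 2 * t)" unfolding inner_a[OF e] .
      have "0 \<le> pi / 2 * r" "pi / 2 * r \<le> pi" if r: "r \<in> {0..1}" for r
      proof -
        show "0 \<le> pi / 2 * r" using r by simp
        have "pi / 2 * r \<le> pi / 2 * 1" using r by (intro mult_left_mono) auto
        then show "pi / 2 * r \<le> pi" using pi_gt_zero by linarith
      qed
      note bounds = this[OF st(1)] this[OF st(2)]
      have "pi / 2 * s = pi / 2 * t"
        by (rule cos_inj_pi[OF bounds eq])
      then show "s = t" by simp
    qed
    have "c e 0 = pos (a e)" "c e 1 = pos (b e)" unfolding c_def by simp_all
    then show "{{c e 0}, {c e 1}} = (\<lambda>v. {pos v}) ` e" using arg_cong[OF conjunct1[OF E], of "image (\<lambda>v. {pos v})"] by simp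
    show "(\<lambda>t. {c e t}) ` {0<..<1} \<inter> (\<lambda>v. {pos v}) ` vertices G = {}"
    proof (rule ccontr)
      assume "\<not> ?thesis"
      then obtain t v where "0 < t" "t < 1" and v: "v \<in> vertices G" "c e t = pos v" by auto
      then have t: "t \<in> {0<..<1}" by simp
      have "e = {v}" using pull_c[OF e t] pull_pos[OF v(1)] unfolding v(2) by blast
      then have "{a e, b e} = {v}" using trans[OF conjunct1[OF E, symmetric]] by blast
      then show False using conjunct2[OF E] by auto
    qed
    fix f assume f: "f \<in> edges G" "e \<noteq> f"
    show "(\<lambda>t. {c e t}) ` {0<..<1} \<inter> (\<lambda>t. {c f t}) ` {0<..<1} = {}"
    proof (rule ccontr)
      assume "\<not> ?thesis"
      then obtain s t where "0 < s" "s < 1" "0 < t" "t < 1" and st: "c e s = c f t" by auto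
      then have "pull (c e s) = e" "pull (c f t) = f"
        using pull_c[OF e, of s] pull_c[OF f(1), of t] by simp_all
      then show False using st f(2) by simp
    qed
  qed
qed

text \<open>
  The vertices of a regular tetrahedron inscribed in a cube with edges of length 2; the
  midpoints of its six edges form a regular octahedron.
\<close>

definition tetrahedron :: "nat \<Rightarrow> complex \<times> real" where
  "tetrahedron i = [(Complex 1 1, 1), (Complex 1 (-1), -1), (Complex (-1) 1, -1), (Complex (-1) (-1), 1)] ! i"

lemma inner_tetrahedron:
  assumes "i < 4" "j < 4"
  shows "tetrahedron i \<bullet> tetrahedron j = (if i = j then 3 else -1)"
proof -
  have "i \<in> {0, 1, 2, 3}" "j \<in> {0, 1, 2, 3}" using assms by auto
  then show ?thesis
    unfolding tetrahedron_def by (auto simp: inner_complex_def numeral_2_eq_2 numeral_3_eq_3)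
qed

text \<open>
  An edge of the graph is placed at the midpoint of the corresponding edge of the tetrahedron.
  The inner product of two such midpoints is the number of common endpoints minus one.
\<close>

lemma drawable_on_sphere_line_graph:
  assumes Z: "finite Z" "card Z \<le> 4" and E: "\<And>e. e \<in> edges G \<Longrightarrow> e \<subseteq> Z \<and> card e = 2"
  shows "drawable_on (line_graph G) (crosscap_surface 0)"
proof -
  obtain h where "bij_betw h Z {0..<card Z}" using ex_bij_betw_finite_nat[OF Z(1)] by blast
  then have h: "inj_on h Z" "h ` Z = {0..<card Z}"
    unfolding bij_betw_def by auto
  have h4: "h x < 4" if "x \<in> Z" for x
    using imageI[OF that, of h] Z(2) unfolding h(2) by simp
  define pos where "pos e = (1 / 2) *\<^sub>R (\<Sum>x\<in>e. tetrahedron (h x))" for e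
  have inner: "pos e \<bullet> pos f = real (card (e \<inter> f)) - 1" if ef: "e \<in> edges G" "f \<in> edges G" for e f
  proof -
    note * = E[OF ef(1)] E[OF ef(2)]
    have fin: "finite e" "finite f" using * Z(1) finite_subset by auto
    have "(\<Sum>x\<in>e. tetrahedron (h x)) \<bullet> (\<Sum>y\<in>f. tetrahedron (h y)) = (\<Sum>x\<in>e. \<Sum>y\<in>f. tetrahedron (h x) \<bullet> tetrahedron (h y))"
      by (subst inner_sum_left) (simp only: inner_sum_right)
    also have "\<dots> = (\<Sum>x\<in>e. \<Sum>y\<in>f. (if x = y then 4 else 0) - 1)"
    proof (intro sum.cong refl)
      fix x y assume "x \<in> e" "y \<in> f"
      then have xy: "x \<in> Z" "y \<in> Z" using * by auto
      then show "tetrahedron (h x) \<bullet> tetrahedron (h y) = (if x = y then 4 else 0) - 1"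
        using inner_tetrahedron[OF h4[OF xy(1)] h4[OF xy(2)]] inj_on_eq_iff[OF h(1) xy] by simp
    qed
    also have "\<dots> = (\<Sum>x\<in>e. (if x \<in> f then 4 else 0) - 2)"
      using fin * by (intro sum.cong refl) (simp add: sum_subtractf)
    also have "\<dots> = 4 * real (card (e \<inter> f)) - 4"
      using fin * by (simp add: sum_subtractf sum.If_cases)
    finally show ?thesis unfolding pos_def by simp
  qed
  have fin: "finite e" if "e \<in> edges G" for e using E[OF that] Z(1) finite_subset by auto
  have meet: "card (e \<inter> f) \<le> 1" if "e \<in> edges G" "f \<in> edges G" "e \<noteq> f" for e f
  proof (rule ccontr)
    assume "\<not> ?thesis"
    then have "card e \<le> card (e \<inter> f)" "card f \<le> card (e \<inter> f)"
      using E[OF that(1)] E[OF that(2)] by auto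
    then have "e \<inter> f = e" "e \<inter> f = f"
      using card_seteq[OF fin[OF that(1)], of "e \<inter> f"] card_seteq[OF fin[OF that(2)], of "e \<inter> f"] by auto
    then show False using that(3) by simp
  qed
  show ?thesis
  proof (rule drawable_on_sphere[of _ pos])
    fix e assume e: "e \<in> vertices (line_graph G)"
    then have e: "e \<in> edges G" unfolding line_graph_def by simp
    show "norm (pos e) = 1"
      unfolding norm_eq_1 inner[OF e e] using E[OF e] by simp
    fix f assume f: "f \<in> vertices (line_graph G)" "e \<noteq> f"
    then have f: "f \<in> edges G" "e \<noteq> f" unfolding line_graph_def by simp_all
    show "pos e \<bullet> pos f \<le> 0" unfolding inner[OF e f(1)] using meet[OF e f] by simp
  next
    fix k assume "k \<in> edges (line_graph G)"
    then obtain e f where k: "k = {e, f}" and ef: "e \<in> edges G" "f \<in> edges G" "e \<noteq> f" "e \<inter> f \<noteq> {}"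
      unfolding line_graph_def by auto
    have "card (e \<inter> f) \<noteq> 0" using ef(4) fin[OF ef(1)] by simp
    then have "card (e \<inter> f) = 1" using meet[OF ef(1-3)] by linarith
    then have "pos e \<bullet> pos f = 0" unfolding inner[OF ef(1,2)] by simp
    then show "\<exists>u v. k = {u, v} \<and> u \<in> vertices (line_graph G) \<and> v \<in> vertices (line_graph G) \<and> u \<noteq> v \<and> pos u \<bullet> pos v = 0"
      using k ef unfolding line_graph_def by (intro exI[of _ e] exI[of _ f]) simp
  qed
qed

section \<open>Line graphs of complete graphs\<close>

text \<open>
  An edge of the line graph is given by a vertex \<open>u\<close> and a pair of further
  vertices; \<open>u\<close> is recovered as the common point of the two edges.
\<close>

lemma card_line_graph_complete:
  fixes Z :: "'v set"
  assumes Z: "finite Z" and E: "edges G = {e. e \<subseteq> Z \<and> card e = 2}"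
  shows "card (vertices (line_graph G)) = card Z choose 2"
    and "finite (edges (line_graph G))"
    and "card Z * ((card Z - 1) choose 2) \<le> card (edges (line_graph G))"
proof -
  show "card (vertices (line_graph G)) = card Z choose 2"
    unfolding line_graph_def using n_subsets[OF Z] E by simp
  have "finite (edges G)" unfolding E using Z by simp
  then have "finite (Pow (edges G))" by simp
  then show fin: "finite (edges (line_graph G))"
    by (rule rev_finite_subset) (auto simp: line_graph_def)
  define S where "S u = {T. T \<subseteq> Z - {u} \<and> card T = 2}" for u
  define F :: "'v \<times> 'v set \<Rightarrow> 'v set set" where "F = (\<lambda>(u, T). (\<lambda>x. {u, x}) ` T)"
  have "card (Sigma Z S) = (\<Sum>u\<in>Z. card (S u))"
    using Z unfolding S_def by (intro card_SigmaI) auto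
  also have "\<dots> = (\<Sum>u\<in>Z. (card Z - 1) choose 2)"
    unfolding S_def using Z n_subsets[of "Z - {_}" 2] by (intro sum.cong refl) simp
  finally have card: "card (Sigma Z S) = card Z * ((card Z - 1) choose 2)" by simp
  have "F ` Sigma Z S \<subseteq> edges (line_graph G)"
  proof
    fix k assume "k \<in> F ` Sigma Z S"
    then obtain u T where uT: "k = F (u, T)" "u \<in> Z" "T \<subseteq> Z - {u}" "card T = 2" unfolding S_def by auto
    then obtain v w where T: "T = {v, w}" "v \<noteq> w" by (auto simp: card_2_iff)
    have "{u, v} \<in> edges G" "{u, w} \<in> edges G" using uT T unfolding E by auto
    moreover have "k = {{u, v}, {u, w}}" unfolding uT(1) F_def T by simp
    moreover have "{u, v} \<noteq> {u, w}" using T(2) by (auto simp: doubleton_eq_iff)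
    ultimately show "k \<in> edges (line_graph G)" unfolding line_graph_def by auto
  qed
  moreover have "inj_on F (Sigma Z S)"
  proof (rule inj_on_inverseI)
    fix q assume "q \<in> Sigma Z S"
    then obtain u T where q: "q = (u, T)" "T \<subseteq> Z - {u}" "card T = 2" unfolding S_def by auto
    then obtain v w where T: "T = {v, w}" "v \<noteq> w" by (auto simp: card_2_iff)
    have "\<Inter>(F q) = {u}" "\<Union>(F q) - {u} = T" unfolding q(1) F_def using T q(2) by auto
    then show "(the_elem (\<Inter>(F q)), \<Union>(F q) - \<Inter>(F q)) = q" unfolding q(1) by simp
  qed
  ultimately show "card Z * ((card Z - 1) choose 2) \<le> card (edges (line_graph G))"
    unfolding card[symmetric] by (intro card_inj_on_le[of F]) (use fin in auto)
qed

lemma card_line_graph_complete_ge: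
  assumes Z: "finite Z" "6 \<le> card Z" and E: "edges G = {e. e \<subseteq> Z \<and> card e = 2}"
  shows "3 * card (vertices (line_graph G)) + 1 < card (edges (line_graph G))"
proof -
  define n where "n = card Z"
  let ?V = "card (vertices (line_graph G))" and ?E = "card (edges (line_graph G))"
  note C = card_line_graph_complete[OF Z(1) E, folded n_def]
  have two: "2 * (m choose 2) = m * (m - 1)" for m :: nat
    unfolding choose_two by (rule dvd_mult_div_cancel) (cases "even m"; simp)
  have n: "6 \<le> n" using Z(2) unfolding n_def .
  have V: "2 * ?V = n * (n - 1)" using two C(1) by simp
  have "4 * (2 * ?V) \<le> (n - 2) * (n * (n - 1))" unfolding V using n by (intro mult_right_mono) auto
  also have "\<dots> = n * (2 * ((n - 1) choose 2))" unfolding two by (simp add: mult_ac numeral_2_eq_2)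
  also have "\<dots> \<le> 2 * ?E" using C(3) by simp
  finally have "4 * ?V \<le> ?E" by simp
  moreover have "6 * 5 \<le> n * (n - 1)" using n by (intro mult_mono) auto
  then have "15 \<le> ?V" using V by linarith
  ultimately show ?thesis by linarith
qed

section \<open>The essential graph of a finite local ring\<close>

locale finite_local_cring = cring +
  fixes M :: "'a set"
  assumes finite_carrier: "finite (carrier R)"
    and maximal: "maximalideal M R" and unique: "\<And>N. maximalideal N R \<Longrightarrow> N = M"
begin

sublocale M: maximalideal M R by (fact maximal)

lemma one_notin_M: "\<one> \<notin> M"
  using M.one_imp_carrier M.I_notcarr by blast

text \<open>
  Among the finitely many proper ideals above \<open>I\<close>, one that is maximal under
  inclusion is a maximal ideal of the ring, hence \<open>M\<close>.
\<close>

lemma proper_ideal_subset_M: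
  assumes "ideal I R" "I \<noteq> carrier R"
  shows "I \<subseteq> M"
proof -
  define P where "P = {J. ideal J R \<and> I \<subseteq> J \<and> J \<noteq> carrier R}"
  have "P \<subseteq> Pow (carrier R)" unfolding P_def by (auto dest: ideal.Icarr)
  then have fin: "finite P" by (rule finite_subset) (simp add: finite_carrier)
  have ne: "P \<noteq> {}" unfolding P_def using assms by blast
  obtain N where N: "N \<in> P" "\<And>J. \<lbrakk>J \<in> P; N \<subseteq> J\<rbrakk> \<Longrightarrow> N = J"
    using finite_has_maximal[OF fin ne] by blast
  have "maximalideal N R"
  proof (rule maximalidealI)
    show "ideal N R" "carrier R \<noteq> N" using N(1) unfolding P_def by auto
    fix J assume J: "ideal J R" "N \<subseteq> J" "J \<subseteq> carrier R"
    then show "J = N \<or> J = carrier R" using N unfolding P_def by blast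
  qed
  then show ?thesis using unique N(1) unfolding P_def by blast
qed

lemma nonunit_in_M:
  assumes "x \<in> carrier R" "x \<notin> Units R"
  shows "x \<in> M"
proof -
  have "\<one> \<notin> PIdl x"
  proof
    assume "\<one> \<in> PIdl x"
    then obtain y where y: "y \<in> carrier R" "\<one> = y \<otimes> x" unfolding cgenideal_def by blast
    then have "x \<in> Units R" unfolding Units_def using assms(1) m_comm by auto
    then show False using assms(2) by blast
  qed
  then have "PIdl x \<subseteq> M"
    by (intro proper_ideal_subset_M cgenideal_ideal assms(1)) auto
  then show ?thesis using cgenideal_self[OF assms(1)] by blast
qed

lemma zero_divisor_in_M:
  assumes "x \<in> carrier R" "y \<in> carrier R" "y \<noteq> \<zero>" "x \<otimes> y = \<zero>"
  shows "x \<in> M"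
proof (rule nonunit_in_M[OF assms(1)])
  show "x \<notin> Units R"
  proof
    assume x: "x \<in> Units R"
    have "y = inv x \<otimes> (x \<otimes> y)" using x assms(1,2) by (simp add: m_assoc[symmetric])
    then show False using assms(3,4) x by simp
  qed
qed

text \<open>
  Two powers \<open>x\<^sup>i\<close> and \<open>x\<^sup>i x\<^sup>d\<close> coincide, and
  \<open>1 - x\<^sup>d\<close> is a unit because it lies outside \<open>M\<close>.
\<close>

lemma nilpotent_M:
  assumes x: "x \<in> M"
  obtains k :: nat where "x [^] k = \<zero>"
proof -
  have xc: "x \<in> carrier R" using x M.Icarr by blast
  have "\<not> inj (\<lambda>k::nat. x [^] k)"
  proof
    assume "inj (\<lambda>k::nat. x [^] k)"
    moreover have "range (\<lambda>k::nat. x [^] k) \<subseteq> carrier R" using xc by auto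
    ultimately show False using finite_carrier finite_subset finite_imageD infinite_UNIV_nat by metis
  qed
  then obtain i j :: nat where ij: "i < j" "x [^] i = x [^] j"
    unfolding inj_def by (metis nat_neq_iff)
  define d where "d = j - i"
  have j: "x [^] j = x [^] i \<otimes> x [^] d" unfolding d_def using xc ij(1) by (simp add: nat_pow_mult)
  obtain c where c: "d = Suc c" using ij(1) unfolding d_def by (metis Suc_diff_Suc)
  have "x [^] d \<in> M" unfolding c nat_pow_Suc using M.I_l_closed[OF x] xc by simp
  have "\<one> \<ominus> x [^] d \<in> Units R"
  proof (rule ccontr)
    assume "\<not> ?thesis"
    then have "\<one> \<ominus> x [^] d \<in> M" using nonunit_in_M xc by simp
    then have "(\<one> \<ominus> x [^] d) \<oplus> x [^] d \<in> M" using \<open>x [^] d \<in> M\<close> M.a_closed by blast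
    also have "(\<one> \<ominus> x [^] d) \<oplus> x [^] d = \<one>" using xc by (simp add: minus_eq a_assoc l_neg)
    finally show False using one_notin_M by blast
  qed
  moreover have "(\<one> \<ominus> x [^] d) \<otimes> x [^] i = \<zero>"
  proof -
    have "(\<one> \<ominus> x [^] d) \<otimes> x [^] i = x [^] i \<ominus> x [^] i \<otimes> x [^] d"
      using xc by (simp add: minus_eq l_distr r_distr l_minus r_minus m_comm)
    also have "\<dots> = \<zero>" using j ij(2) xc by (simp add: minus_eq r_neg)
    finally show ?thesis .
  qed
  ultimately have "x [^] i = \<zero>"
    using one_notin_M zero_divisor_in_M[of "\<one> \<ominus> x [^] d" "x [^] i"] xc
    by (metis M.I_l_closed Units_closed Units_inv_closed Units_l_inv nat_pow_closed)
  then show thesis by (rule that)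
qed

text \<open>
  The last nonzero term of the sequence \<open>y, x y, x\<^sup>2 y, \<dots>\<close> is killed by
  \<open>x\<close>.
\<close>

lemma nilpotent_kills:
  assumes x: "x \<in> M" and y: "y \<in> carrier R" "y \<noteq> \<zero>"
  obtains k :: nat where "x [^] k \<otimes> y \<noteq> \<zero>" "x \<otimes> (x [^] k \<otimes> y) = \<zero>"
proof -
  have xc: "x \<in> carrier R" using x M.Icarr by blast
  obtain n :: nat where "x [^] n = \<zero>" using nilpotent_M[OF x] .
  then have ex: "x [^] n \<otimes> y = \<zero>" using y by simp
  define m where "m = (LEAST m. x [^] (m::nat) \<otimes> y = \<zero>)"
  have m: "x [^] m \<otimes> y = \<zero>" unfolding m_def by (rule LeastI[of _ n]) (rule ex)
  have "m \<noteq> 0"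
  proof
    assume "m = 0"
    then show False using m y by simp
  qed
  then obtain k where k: "m = Suc k" using not0_implies_Suc by blast
  show thesis
  proof
    show "x [^] k \<otimes> y \<noteq> \<zero>"
      using not_less_Least[of k "\<lambda>m. x [^] m \<otimes> y = \<zero>"] unfolding m_def[symmetric] k by simp
    have "x \<otimes> (x [^] k \<otimes> y) = x [^] m \<otimes> y"
      unfolding k using xc y(1) by (simp add: m_assoc[symmetric] m_comm)
    then show "x \<otimes> (x [^] k \<otimes> y) = \<zero>" using m by simp
  qed
qed

lemma nonzero_zero_divisors_eq: "nonzero_zero_divisors R = M - {\<zero>}"
proof
  show "nonzero_zero_divisors R \<subseteq> M - {\<zero>}"
    unfolding nonzero_zero_divisors_def using zero_divisor_in_M by blast
  show "M - {\<zero>} \<subseteq> nonzero_zero_divisors R"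
  proof
    fix x assume x: "x \<in> M - {\<zero>}"
    have "\<one> \<noteq> \<zero>" using one_notin_M M.zero_closed by metis
    then obtain k :: nat where "x [^] k \<otimes> \<one> \<noteq> \<zero>" "x \<otimes> (x [^] k \<otimes> \<one>) = \<zero>"
      using nilpotent_kills[of x \<one>] x by blast
    moreover have "x \<in> carrier R" using x M.Icarr by blast
    ultimately show "x \<in> nonzero_zero_divisors R"
      unfolding nonzero_zero_divisors_def using x by (auto intro!: bexI[of _ "x [^] k \<otimes> \<one>"])
  qed
qed

lemma ideal_annihilator:
  assumes "s \<in> carrier R"
  shows "ideal (annihilator R s) R"
proof (rule idealI[OF ring_axioms])
  show "subgroup (annihilator R s) (add_monoid R)"
    by (rule add.subgroupI)
       (use assms in \<open>auto simp: annihilator_def r_distr r_minus a_inv_def[symmetric] intro: exI[of _ \<zero>]\<close>)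
  fix a x assume "a \<in> annihilator R s" "x \<in> carrier R"
  then have "s \<otimes> (x \<otimes> a) = \<zero>" "a \<otimes> x = x \<otimes> a" "x \<otimes> a \<in> carrier R"
    using assms m_lcomm[of s x a] m_comm[of a x] by (auto simp: annihilator_def)
  then show "x \<otimes> a \<in> annihilator R s" "a \<otimes> x \<in> annihilator R s"
    unfolding annihilator_def by auto
qed

lemma essential_annihilator:
  assumes s: "s \<in> M"
  shows "essential_ideal (annihilator R s) R"
  unfolding essential_ideal_def
proof (intro conjI allI impI)
  have sc: "s \<in> carrier R" using s M.Icarr by blast
  then show "ideal (annihilator R s) R" by (rule ideal_annihilator)
  fix J assume "ideal J R \<and> J \<noteq> {\<zero>}"
  then interpret J: ideal J R by simp
  obtain y where y: "y \<in> J" "y \<noteq> \<zero>" using \<open>ideal J R \<and> J \<noteq> {\<zero>}\<close> J.zero_closed by blast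
  obtain k :: nat where k: "s [^] k \<otimes> y \<noteq> \<zero>" "s \<otimes> (s [^] k \<otimes> y) = \<zero>"
    using nilpotent_kills[OF s J.Icarr[OF y(1)] y(2)] .
  have "s [^] k \<otimes> y \<in> J" using J.I_l_closed[OF y(1)] sc by simp
  then have "s [^] k \<otimes> y \<in> annihilator R s \<inter> J" unfolding annihilator_def using k(2) J.Icarr by auto
  then show "annihilator R s \<inter> J \<noteq> {\<zero>}" using k(1) by blast
qed

lemma edges_essential_graph:
  "edges (essential_graph R) = {e. e \<subseteq> M - {\<zero>} \<and> card e = 2}"
proof -
  have "essential_ideal (annihilator R (u \<otimes> v)) R" if "u \<in> M" "v \<in> M" for u v
    by (rule essential_annihilator) (use that M.I_l_closed M.Icarr in blast)
  then have "e \<in> edges (essential_graph R) \<longleftrightarrow> (\<exists>u v. e = {u, v} \<and> u \<in> M - {\<zero>} \<and> v \<in> M - {\<zero>} \<and> u \<noteq> v)" for e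
    unfolding essential_graph_def nonzero_zero_divisors_eq by auto
  also have "\<dots> e \<longleftrightarrow> e \<subseteq> M - {\<zero>} \<and> card e = 2" for e
    unfolding card_2_iff by blast
  finally show ?thesis by blast
qed

text \<open>
  Cauchy's theorem for the additive group of \<open>M\<close>, obtained from a Sylow subgroup;
  since the exponent of \<open>p\<close> is chosen as 1, the subgroup has exactly
  \<open>p\<close> elements.
\<close>

lemma element_of_prime_order:
  assumes "prime p" "card M = p * m"
  obtains x where "x \<in> M" "x \<noteq> \<zero>" "x [^]\<^bsub>add_monoid R\<^esub> p = \<zero>"
proof -
  interpret A: group "add_monoid R" by (rule a_group)
  interpret MA: subgroup M "add_monoid R" by (rule M.a_subgroup)
  let ?M = "(add_monoid R)\<lparr>carrier := M\<rparr>"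
  have M: "group ?M" by (rule subgroup.subgroup_is_group) unfold_locales
  have fin: "finite M" using finite_subset[OF _ finite_carrier] M.Icarr by blast
  obtain H where H: "subgroup H ?M" "card H = p ^ 1"
    using sylow_thm[OF assms(1) M, of 1 m] assms(2) fin unfolding order_def by auto
  interpret H: group "?M\<lparr>carrier := H\<rparr>" by (rule subgroup.subgroup_is_group[OF H(1) M])
  have HM: "H \<subseteq> M" using subgroup.subset[OF H(1)] by simp
  have zH: "\<zero> \<in> H" using subgroup.one_closed[OF H(1)] by simp
  have "\<not> H \<subseteq> {\<zero>}"
  proof
    assume "H \<subseteq> {\<zero>}"
    then have "card H \<le> 1" using card_mono[of "{\<zero>}" H] by simp
    then show False using H(2) prime_gt_1_nat[OF assms(1)] by simp
  qed
  then obtain x where x: "x \<in> H" "x \<noteq> \<zero>" by blast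
  have "x [^]\<^bsub>?M\<lparr>carrier := H\<rparr>\<^esub> order (?M\<lparr>carrier := H\<rparr>) = \<one>\<^bsub>?M\<lparr>carrier := H\<rparr>\<^esub>"
    using x(1) by (intro H.pow_order_eq_1) simp
  then have "x [^]\<^bsub>add_monoid R\<^esub> p = \<zero>"
    using H(2) by (simp add: order_def nat_pow_def)
  then show thesis using that x HM by blast
qed

text \<open>
  The elements of order 2 and 3 make \<open>1 + 1\<close> and \<open>1 + 1 + 1\<close> zero
  divisors, so both lie in \<open>M\<close>, and so does their difference.
\<close>

lemma card_M_neq_6: "card M \<noteq> 6"
proof
  assume six: "card M = 6"
  obtain x where x: "x \<in> M" "x \<noteq> \<zero>" "x [^]\<^bsub>add_monoid R\<^esub> (2::nat) = \<zero>"
    using element_of_prime_order[of 2 3] six by auto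
  obtain y where y: "y \<in> M" "y \<noteq> \<zero>" "y [^]\<^bsub>add_monoid R\<^esub> (3::nat) = \<zero>"
    using element_of_prime_order[of 3 2] six by auto
  have c: "x \<in> carrier R" "y \<in> carrier R" using x y M.Icarr by auto
  have x2: "x \<oplus> x = \<zero>" and y3: "y \<oplus> y \<oplus> y = \<zero>"
    using x(3) y(3) c by (simp_all add: numeral_2_eq_2 numeral_3_eq_3 nat_pow_def)
  have "(\<one> \<oplus> \<one>) \<otimes> x = \<zero>" using x2 c by (simp add: l_distr)
  then have t: "\<one> \<oplus> \<one> \<in> M" using zero_divisor_in_M[of _ x] c x by simp
  have "(\<one> \<oplus> \<one> \<oplus> \<one>) \<otimes> y = \<zero>" using y3 c by (simp add: l_distr)
  then have s: "\<one> \<oplus> \<one> \<oplus> \<one> \<in> M" using zero_divisor_in_M[of _ y] c y by simp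
  have "\<ominus> (\<one> \<oplus> \<one>) \<oplus> (\<one> \<oplus> \<one> \<oplus> \<one>) \<in> M" using s t M.a_inv_closed M.a_closed by blast
  also have "\<ominus> (\<one> \<oplus> \<one>) \<oplus> (\<one> \<oplus> \<one> \<oplus> \<one>) = \<one>" by (rule r_neg1) simp_all
  finally show False using one_notin_M by blast
qed

end

section \<open>The crosscap number\<close>

lemma crosscap_number_eq_enat_iff:
  "crosscap_number G = enat k \<longleftrightarrow>
    drawable_on G (crosscap_surface k) \<and> (\<forall>j<k. \<not> drawable_on G (crosscap_surface j))"
proof -
  define D where "D = {enat k | k. drawable_on G (crosscap_surface k)}"
  have D: "enat j \<in> D \<longleftrightarrow> drawable_on G (crosscap_surface j)" for j
    unfolding D_def by auto
  have num: "crosscap_number G = Inf D" unfolding crosscap_number_def D_def ..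
  show ?thesis
  proof
    assume k: "crosscap_number G = enat k"
    then have "D \<noteq> {}" unfolding num by (auto simp: Inf_enat_def)
    then have "Inf D \<in> D" unfolding Inf_enat_def by (auto intro: LeastI)
    moreover have "\<not> drawable_on G (crosscap_surface j)" if "j < k" for j
    proof
      assume "drawable_on G (crosscap_surface j)"
      then have "Inf D \<le> enat j" using D by (intro Inf_lower) simp
      then show False using k that unfolding num by simp
    qed
    ultimately show "drawable_on G (crosscap_surface k) \<and> (\<forall>j<k. \<not> drawable_on G (crosscap_surface j))"
      using k D unfolding num by auto
  next
    assume k: "drawable_on G (crosscap_surface k) \<and> (\<forall>j<k. \<not> drawable_on G (crosscap_surface j))"
    show "crosscap_number G = enat k" unfolding num
    proof (rule antisym)
      show "Inf D \<le> enat k" using k D by (intro Inf_lower) simp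
      show "enat k \<le> Inf D"
        using k unfolding D_def by (intro Inf_greatest) (auto simp: not_less[symmetric])
    qed
  qed
qed

theorem theorem5p1:
  fixes A :: "('a, 'm) ring_scheme"
  assumes "cring A" and "\<one>\<^bsub>A\<^esub> \<noteq> \<zero>\<^bsub>A\<^esub>"
    and "finite (carrier A)"
    and "local_ring A"
  shows "crosscap_number (line_graph (essential_graph A)) \<noteq> 1 \<and>
    crosscap_number (line_graph (essential_graph A)) \<noteq> 2"
proof -
  obtain M where M: "maximalideal M A" "\<And>N. maximalideal N A \<Longrightarrow> N = M"
    using assms(4) unfolding local_ring_def by blast
  interpret finite_local_cring A M
    by (intro finite_local_cring.intro finite_local_cring_axioms.intro assms(1,3) M)
  let ?Z = "M - {\<zero>\<^bsub>A\<^esub>}" and ?L = "line_graph (essential_graph A)"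
  have fin: "finite ?Z" using finite_subset[OF _ finite_carrier] M.Icarr by blast
  have card: "card ?Z \<noteq> 5"
    using card_M_neq_6 card_Suc_Diff1[of M "\<zero>\<^bsub>A\<^esub>"] fin M.zero_closed by auto
  have L: "crosscap_number ?L \<noteq> enat 1 \<and> crosscap_number ?L \<noteq> enat 2"
  proof (cases "card ?Z \<le> 4")
    case True
    then have "drawable_on ?L (crosscap_surface 0)"
      by (intro drawable_on_sphere_line_graph[OF fin]) (auto simp: edges_essential_graph)
    then show ?thesis unfolding crosscap_number_eq_enat_iff by (auto intro: exI[of _ 0])
  next
    case False
    then have six: "6 \<le> card ?Z" using card by linarith
    note many = card_line_graph_complete_ge[OF fin six edges_essential_graph]
    have V: "vertices ?L = edges (essential_graph A)" unfolding line_graph_def by simp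
    have G: "finite (vertices ?L)" "finite (edges ?L)" "\<And>e. e \<in> edges ?L \<Longrightarrow> e \<subseteq> vertices ?L"
    proof -
      show "finite (vertices ?L)" unfolding V edges_essential_graph using fin by simp
      show "finite (edges ?L)" by (rule card_line_graph_complete(2)[OF fin edges_essential_graph])
      show "\<And>e. e \<in> edges ?L \<Longrightarrow> e \<subseteq> vertices ?L" unfolding line_graph_def by auto
    qed
    show ?thesis
      using card_edges_le_crosscap_1[OF G] card_edges_le_crosscap_2[OF G] many
      unfolding crosscap_number_eq_enat_iff by auto
  qed
  then show ?thesis by (simp add: one_enat_def numeral_eq_enat)
qed

end
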